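(* Let $\mathcal{L}$ be a language and let $M_1,\ldots,M_n$ be $\mathcal{L}$-structures such that: (1) each $M_i$ is model complete; (2) for every $\aleph_0$-saturated $\mathcal{L}$-structure $S\equiv M_1\times\cdots\times M_n$ there are $\mathcal{L}$-structures $M'_1\equiv M_1,\ldots,M'_n\equiv M_n$ with $S\cong M'_1\times\cdots\times M'_n$; (3) for all $\mathcal{L}$-structures $M'_i\equiv M_i\equiv M''_i$ ($i=1,\ldots,n$) and every embedding $\Psi:M'_1\times\cdots\times M'_n\to M''_1\times\cdots\times M''_n$, there exist $\sigma\in\mathrm{Sym}(n)$ and embeddings $\Psi_i:M'_i\to M''_{\sigma(i)}$ ($i=1,\ldots,n$) such that $\Psi=\widetilde{\sigma^{-1}}\circ(\Psi_1\times\cdots\times\Psi_n)$, where $\widetilde{\sigma^{-1}}:M''_{\sigma(1)}\times\cdots\times M''_{\sigma(n)}\to M''_1\times\cdots\times M''_n$ is the coordinate permutation, and $M'_i\equiv M''_{\sigma(i)}$ for each $i$. Then $M_1\times\cdots\times M_n$ is model complete.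
   Context: Products of $\mathcal{L}$-structures are direct products with coordinatewise interpretation of symbols. A structure is model complete if its complete theory is model complete. *)

theory Defs
  imports Main "HOL-Library.FuncSet" "HOL-Library.Equipollence"
    "HOL-Combinatorics.Permutations"
begin

section \<open>First-order languages and structures\<close>

text \<open>The symbols are given by sets rather than by whole types, so that a language may have
  no function symbols or no relation symbols. Constants are function symbols of arity 0.\<close>

record ('f, 'r) lang =
  fsyms :: "'f set"
  farity :: "'f \<Rightarrow> nat"
  rsyms :: "'r set"
  rarity :: "'r \<Rightarrow> nat"

text \<open>Only the values of the interpretations at symbols of the language and at tuples from the
  universe of the right length are meaningful.\<close>

record ('f, 'r, 'a) struct =
  univ :: "'a set"
  fint :: "'f \<Rightarrow> 'a list \<Rightarrow> 'a"
  rint :: "'r \<Rightarrow> 'a list \<Rightarrow> bool"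

definition tuples :: "'a set \<Rightarrow> nat \<Rightarrow> 'a list set" where
  "tuples A k = {xs. set xs \<subseteq> A \<and> length xs = k}"

definition is_structure :: "('f, 'r) lang \<Rightarrow> ('f, 'r, 'a) struct \<Rightarrow> bool" where
  "is_structure L M \<longleftrightarrow> univ M \<noteq> {} \<and>
     (\<forall>f\<in>fsyms L. \<forall>xs\<in>tuples (univ M) (farity L f). fint M f xs \<in> univ M)"

definition embedding ::
  "('f, 'r) lang \<Rightarrow> ('f, 'r, 'a) struct \<Rightarrow> ('f, 'r, 'b) struct \<Rightarrow> ('a \<Rightarrow> 'b) \<Rightarrow> bool" where
  "embedding L M N h \<longleftrightarrow>
     h ` univ M \<subseteq> univ N \<and> inj_on h (univ M) \<and>
     (\<forall>f\<in>fsyms L. \<forall>xs\<in>tuples (univ M) (farity L f). h (fint M f xs) = fint N f (map h xs)) \<and>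
     (\<forall>r\<in>rsyms L. \<forall>xs\<in>tuples (univ M) (rarity L r). rint M r xs \<longleftrightarrow> rint N r (map h xs))"

definition isomorphic ::
  "('f, 'r) lang \<Rightarrow> ('f, 'r, 'a) struct \<Rightarrow> ('f, 'r, 'b) struct \<Rightarrow> bool" where
  "isomorphic L M N \<longleftrightarrow> (\<exists>h. embedding L M N h \<and> h ` univ M = univ N)"

definition substructure ::
  "('f, 'r) lang \<Rightarrow> ('f, 'r, 'a) struct \<Rightarrow> ('f, 'r, 'a) struct \<Rightarrow> bool" where
  "substructure L M N \<longleftrightarrow> univ M \<subseteq> univ N \<and> embedding L M N (\<lambda>x. x)"

definition product :: "'i set \<Rightarrow> ('i \<Rightarrow> ('f, 'r, 'a) struct) \<Rightarrow> ('f, 'r, 'i \<Rightarrow> 'a) struct" where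
  "product I M =
     \<lparr> univ = (\<Pi>\<^sub>E i\<in>I. univ (M i)),
       fint = (\<lambda>f xs. \<lambda>i\<in>I. fint (M i) f (map (\<lambda>x. x i) xs)),
       rint = (\<lambda>r xs. \<forall>i\<in>I. rint (M i) r (map (\<lambda>x. x i) xs)) \<rparr>"

definition product_map :: "'i set \<Rightarrow> ('i \<Rightarrow> 'a \<Rightarrow> 'b) \<Rightarrow> ('i \<Rightarrow> 'a) \<Rightarrow> 'i \<Rightarrow> 'b" where
  "product_map I h x = (\<lambda>i\<in>I. h i (x i))"

text \<open>For a permutation \<open>\<tau>\<close> of \<open>I\<close>, the tuple whose \<open>j\<close>-th coordinate is the
  \<open>\<tau> j\<close>-th coordinate of \<open>y\<close>. With \<open>\<tau> = inv \<sigma>\<close> it sends a tuple with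
  \<open>y i \<in> N (\<sigma> i)\<close> to a tuple with \<open>j\<close>-th coordinate in \<open>N j\<close>.\<close>

definition coord_perm :: "'i set \<Rightarrow> ('i \<Rightarrow> 'i) \<Rightarrow> ('i \<Rightarrow> 'a) \<Rightarrow> 'i \<Rightarrow> 'a" where
  "coord_perm I \<tau> y = (\<lambda>j\<in>I. y (\<tau> j))"


section \<open>Formulas and satisfaction\<close>

datatype 'f trm = Var nat | App 'f "'f trm list"

datatype ('f, 'r) fm =
    Eq "'f trm" "'f trm"
  | Rel 'r "'f trm list"
  | Neg "('f, 'r) fm"
  | And "('f, 'r) fm" "('f, 'r) fm"
  | Exists nat "('f, 'r) fm"

primrec wf_trm :: "('f, 'r) lang \<Rightarrow> 'f trm \<Rightarrow> bool" where
  "wf_trm L (Var x) \<longleftrightarrow> True"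
| "wf_trm L (App f ts) \<longleftrightarrow> f \<in> fsyms L \<and> length ts = farity L f \<and> list_all (wf_trm L) ts"

primrec wf_fm :: "('f, 'r) lang \<Rightarrow> ('f, 'r) fm \<Rightarrow> bool" where
  "wf_fm L (Eq s t) \<longleftrightarrow> wf_trm L s \<and> wf_trm L t"
| "wf_fm L (Rel r ts) \<longleftrightarrow> r \<in> rsyms L \<and> length ts = rarity L r \<and> list_all (wf_trm L) ts"
| "wf_fm L (Neg \<phi>) \<longleftrightarrow> wf_fm L \<phi>"
| "wf_fm L (And \<phi> \<psi>) \<longleftrightarrow> wf_fm L \<phi> \<and> wf_fm L \<psi>"
| "wf_fm L (Exists x \<phi>) \<longleftrightarrow> wf_fm L \<phi>"

definition formulas :: "('f, 'r) lang \<Rightarrow> ('f, 'r) fm set" where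
  "formulas L = {\<phi>. wf_fm L \<phi>}"

primrec fv_trm :: "'f trm \<Rightarrow> nat set" where
  "fv_trm (Var x) = {x}"
| "fv_trm (App f ts) = \<Union> (set (map fv_trm ts))"

primrec fv :: "('f, 'r) fm \<Rightarrow> nat set" where
  "fv (Eq s t) = fv_trm s \<union> fv_trm t"
| "fv (Rel r ts) = \<Union> (set (map fv_trm ts))"
| "fv (Neg \<phi>) = fv \<phi>"
| "fv (And \<phi> \<psi>) = fv \<phi> \<union> fv \<psi>"
| "fv (Exists x \<phi>) = fv \<phi> - {x}"

definition sentences :: "('f, 'r) lang \<Rightarrow> ('f, 'r) fm set" where
  "sentences L = {\<phi>\<in>formulas L. fv \<phi> = {}}"

primrec trm_val :: "('f, 'r, 'a) struct \<Rightarrow> (nat \<Rightarrow> 'a) \<Rightarrow> 'f trm \<Rightarrow> 'a" where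
  "trm_val M e (Var x) = e x"
| "trm_val M e (App f ts) = fint M f (map (trm_val M e) ts)"

primrec sat :: "('f, 'r, 'a) struct \<Rightarrow> (nat \<Rightarrow> 'a) \<Rightarrow> ('f, 'r) fm \<Rightarrow> bool" where
  "sat M e (Eq s t) \<longleftrightarrow> trm_val M e s = trm_val M e t"
| "sat M e (Rel r ts) \<longleftrightarrow> rint M r (map (trm_val M e) ts)"
| "sat M e (Neg \<phi>) \<longleftrightarrow> \<not> sat M e \<phi>"
| "sat M e (And \<phi> \<psi>) \<longleftrightarrow> sat M e \<phi> \<and> sat M e \<psi>"
| "sat M e (Exists x \<phi>) \<longleftrightarrow> (\<exists>a\<in>univ M. sat M (e(x := a)) \<phi>)"

definition holds :: "('f, 'r, 'a) struct \<Rightarrow> ('f, 'r) fm \<Rightarrow> bool" where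
  "holds M \<phi> \<longleftrightarrow> (\<forall>e. range e \<subseteq> univ M \<longrightarrow> sat M e \<phi>)"

definition is_model :: "('f, 'r) lang \<Rightarrow> ('f, 'r) fm set \<Rightarrow> ('f, 'r, 'a) struct \<Rightarrow> bool" where
  "is_model L T M \<longleftrightarrow> is_structure L M \<and> (\<forall>\<phi>\<in>T. holds M \<phi>)"

definition complete_theory :: "('f, 'r) lang \<Rightarrow> ('f, 'r, 'a) struct \<Rightarrow> ('f, 'r) fm set" where
  "complete_theory L M = {\<phi>\<in>sentences L. holds M \<phi>}"

definition elem_equiv ::
  "('f, 'r) lang \<Rightarrow> ('f, 'r, 'a) struct \<Rightarrow> ('f, 'r, 'b) struct \<Rightarrow> bool" where
  "elem_equiv L M N \<longleftrightarrow> (\<forall>\<phi>\<in>sentences L. holds M \<phi> \<longleftrightarrow> holds N \<phi>)"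

definition elem_substructure ::
  "('f, 'r) lang \<Rightarrow> ('f, 'r, 'a) struct \<Rightarrow> ('f, 'r, 'a) struct \<Rightarrow> bool" where
  "elem_substructure L M N \<longleftrightarrow> substructure L M N \<and>
     (\<forall>\<phi>\<in>formulas L. \<forall>e. range e \<subseteq> univ M \<longrightarrow> (sat M e \<phi> \<longleftrightarrow> sat N e \<phi>))"


section \<open>Model completeness and saturation\<close>

text \<open>HOL cannot quantify over structures of all types at once, so the type \<open>'u\<close> over which the
  universes of the models range is a parameter. By the downward Loewenheim-Skolem theorem the notion
  does not depend on it as soon as \<open>'u\<close> has at least \<open>|L| + \<aleph>\<^sub>0\<close> elements; with at least
  \<open>2\<^bsup>|L| + \<aleph>\<^sub>0\<^esup>\<close> elements (the number of sets of formulas), \<open>'u\<close> moreover hosts an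
  \<open>\<aleph>\<^sub>0\<close>-saturated model of every consistent theory.\<close>

definition model_complete_theory ::
  "'u itself \<Rightarrow> ('f, 'r) lang \<Rightarrow> ('f, 'r) fm set \<Rightarrow> bool" where
  "model_complete_theory U L T \<longleftrightarrow>
     (\<forall>(A :: ('f, 'r, 'u) struct) (B :: ('f, 'r, 'u) struct).
        is_model L T A \<and> is_model L T B \<and> substructure L A B \<longrightarrow> elem_substructure L A B)"

definition model_complete ::
  "'u itself \<Rightarrow> ('f, 'r) lang \<Rightarrow> ('f, 'r, 'a) struct \<Rightarrow> bool" where
  "model_complete U L M \<longleftrightarrow> model_complete_theory U L (complete_theory L M)"

text \<open>A formula with parameters in \<open>A\<close> in the variables \<open>x\<^sub>0, \<dots>, x\<^sub>k\<^sub>-\<^sub>1\<close> is a pair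
  \<open>(\<phi>, ps)\<close>, where \<open>ps\<close> is a tuple from \<open>A\<close> substituted for the variables with
  indices from \<open>k\<close> on.\<close>

definition param_formulas ::
  "('f, 'r) lang \<Rightarrow> 'a set \<Rightarrow> nat \<Rightarrow> (('f, 'r) fm \<times> 'a list) set" where
  "param_formulas L A k =
     {(\<phi>, ps). \<phi> \<in> formulas L \<and> set ps \<subseteq> A \<and> fv \<phi> \<subseteq> {..<k + length ps}}"

definition realizes ::
  "('f, 'r, 'a) struct \<Rightarrow> 'a list \<Rightarrow> (('f, 'r) fm \<times> 'a list) set \<Rightarrow> bool" where
  "realizes M xs p \<longleftrightarrow> (\<forall>(\<phi>, ps)\<in>p. sat M ((!) (xs @ ps)) \<phi>)"

text \<open>A type over \<open>A\<close> is a set of formulas with parameters in \<open>A\<close> that is consistent with the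
  elementary diagram of \<open>M\<close>, that is, finitely satisfiable in \<open>M\<close>.\<close>

definition is_type ::
  "('f, 'r) lang \<Rightarrow> ('f, 'r, 'a) struct \<Rightarrow> 'a set \<Rightarrow> nat \<Rightarrow> (('f, 'r) fm \<times> 'a list) set \<Rightarrow> bool"
  where
  "is_type L M A k p \<longleftrightarrow> p \<subseteq> param_formulas L A k \<and>
     (\<forall>q. q \<subseteq> p \<and> finite q \<longrightarrow> (\<exists>xs\<in>tuples (univ M) k. realizes M xs q))"

definition aleph0_saturated :: "('f, 'r) lang \<Rightarrow> ('f, 'r, 'a) struct \<Rightarrow> bool" where
  "aleph0_saturated L M \<longleftrightarrow>
     (\<forall>A k p. finite A \<and> A \<subseteq> univ M \<and> is_type L M A k p \<longrightarrow>
        (\<exists>xs\<in>tuples (univ M) k. realizes M xs p))"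

end

theory Submission
  imports Defs
begin

text \<open>Let \<open>A \<subseteq> B\<close> be models of the theory of the product. After shrinking them by
  Loewenheim-Skolem, pass to limit ultrapowers: functions of infinitely many ultrafilter coordinates
  that depend on finitely many of them. For a regular ultrafilter on the finite sets of formulas each
  new coordinate realizes all types over finitely many parameters of the previous stages, so the
  limits of \<open>A\<close> and of \<open>B\<close> are \<open>\<aleph>\<^sub>0\<close>-saturated, have at most
  \<open>2\<^bsup>|L| + \<aleph>\<^sub>0\<^esup>\<close> elements, and the former still embeds into the latter.
  Both decompose into products, the embedding splits into embeddings of the factors, these are
  elementary by model completeness, and a finite product of elementary embeddings is elementary by
  the Feferman-Vaught theorem.\<close>

section \<open>Cardinality bounds\<close>

text \<open>Decomposition and splitting are assumed only for structures with elements in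
  \<open>'u\<close>, a type known merely to have room for all sets of formulas, while the models to
  be compared live in an unrelated type \<open>'v\<close>. This forces the shrinking and the count
  of the limit; \<open>formulas L\<close> serves throughout as the cardinal |L| + aleph0. A second
  obstacle is that both models must become saturated together: extensions chosen separately could
  lose the inclusion, whereas one ultrafilter acts on both alike. In a language of arbitrary size a
  single ultrapower along a merely regular ultrafilter need not realize the types over its own new
  elements. In the limit of infinitely many steps any finite set of parameters already occurs at a
  finite step.\<close>

lemma lepoll_iff_ordLeq: "A \<lesssim> B \<longleftrightarrow> ordLeq3 (card_of A) (card_of B)"
  by (simp add: lepoll_def card_of_ordLeq[symmetric])

lemma UN_lepoll_infinite:
  assumes "infinite K" "I \<lesssim> K" "\<And>i. i \<in> I \<Longrightarrow> A i \<lesssim> K"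
  shows "(\<Union>i\<in>I. A i) \<lesssim> K"
  using assms card_of_UNION_ordLeq_infinite unfolding lepoll_iff_ordLeq by blast

lemma Times_lepoll_infinite:
  assumes "infinite K" "A \<lesssim> K" "B \<lesssim> K"
  shows "A \<times> B \<lesssim> K"
  using assms card_of_Sigma_ordLeq_infinite[of K A "\<lambda>_. B"] unfolding lepoll_iff_ordLeq by blast

lemma Un_lepoll_infinite:
  assumes "infinite K" "A \<lesssim> K" "B \<lesssim> K"
  shows "A \<union> B \<lesssim> K"
proof -
  have "(\<Union>b\<in>UNIV. if b then A else B) \<lesssim> K"
    using assms by (intro UN_lepoll_infinite) (auto intro: finite_lepoll_infinite)
  moreover have "(\<Union>b\<in>UNIV. if b then A else B) = A \<union> B"
    by (auto split: if_splits)
  ultimately show ?thesis by simp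
qed

lemma lists_lepoll_infinite:
  assumes "infinite K" "A \<lesssim> K"
  shows "lists A \<lesssim> K"
proof -
  have len: "{xs \<in> lists A. length xs = n} \<lesssim> K" for n
  proof (induction n)
    case 0
    have "{xs \<in> lists A. length xs = 0} \<subseteq> {[]}" by auto
    then show ?case using assms(1) by (meson finite.emptyI finite.insertI finite_lepoll_infinite finite_subset)
  next
    case (Suc n)
    have "{xs \<in> lists A. length xs = Suc n}
        \<subseteq> (\<lambda>(x, xs). x # xs) ` (A \<times> {xs \<in> lists A. length xs = n})"
      by (auto simp: length_Suc_conv image_iff)
    then have "{xs \<in> lists A. length xs = Suc n} \<lesssim> A \<times> {xs \<in> lists A. length xs = n}"
      by (rule subset_image_lepoll)
    also have "\<dots> \<lesssim> K" by (intro Times_lepoll_infinite assms Suc)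
    finally show ?case .
  qed
  have "lists A = (\<Union>n\<in>UNIV. {xs \<in> lists A. length xs = n})" by auto
  also have "\<dots> \<lesssim> K"
    using assms(1) len by (intro UN_lepoll_infinite) (auto simp: infinite_le_lepoll)
  finally show ?thesis .
qed

lemma Pow_lepoll_mono: "A \<lesssim> B \<Longrightarrow> Pow A \<lesssim> Pow B"
  unfolding lepoll_def by (meson image_Pow_mono inj_on_image_Pow)

text \<open>Trivial equations between variables exist in every language, so
  \<open>formulas L\<close> can play the part of |L| + aleph0 even when the language is finite or
  empty.\<close>

lemma infinite_formulas: "infinite (formulas L)"
proof -
  have "inj (\<lambda>i. Eq (Var i) (Var i) :: ('a, 'b) fm)" by (auto intro: injI)
  moreover have "range (\<lambda>i. Eq (Var i) (Var i)) \<subseteq> formulas L" by (auto simp: formulas_def)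
  ultimately show ?thesis by (metis finite_imageD finite_subset infinite_UNIV_nat)
qed


section \<open>Satisfaction and elementary embeddings\<close>

lemma finite_fv_trm: "finite (fv_trm t)"
  by (induction t) auto

lemma finite_fv: "finite (fv \<phi>)"
  by (induction \<phi>) (auto simp: finite_fv_trm)

lemma trm_val_cong: "(\<And>i. i \<in> fv_trm t \<Longrightarrow> e i = e' i) \<Longrightarrow> trm_val M e t = trm_val M e' t"
proof (induction t)
  case (App f ts)
  then have "map (trm_val M e) ts = map (trm_val M e') ts" by auto
  then show ?case by (simp del: map_eq_conv)
qed auto

lemma sat_cong: "(\<And>i. i \<in> fv \<phi> \<Longrightarrow> e i = e' i) \<Longrightarrow> sat M e \<phi> \<longleftrightarrow> sat M e' \<phi>"
proof (induction \<phi> arbitrary: e e')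
  case (Neg \<phi>)
  have "sat M e \<phi> \<longleftrightarrow> sat M e' \<phi>" using Neg.prems by (intro Neg.IH) auto
  then show ?case by simp
next
  case (Eq s t)
  have "trm_val M e s = trm_val M e' s" "trm_val M e t = trm_val M e' t"
    using Eq by (auto intro!: trm_val_cong)
  then show ?case by simp
next
  case (Rel r ts)
  then have "map (trm_val M e) ts = map (trm_val M e') ts" by (auto intro!: trm_val_cong)
  then show ?case by (simp del: map_eq_conv)
next
  case (And \<phi> \<psi>)
  have "sat M e \<phi> \<longleftrightarrow> sat M e' \<phi>" using And.prems by (intro And.IH) auto
  moreover have "sat M e \<psi> \<longleftrightarrow> sat M e' \<psi>" using And.prems by (intro And.IH) auto
  ultimately show ?case by simp
next
  case (Exists x \<phi>)
  have "sat M (e(x := a)) \<phi> \<longleftrightarrow> sat M (e'(x := a)) \<phi>" for a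
    using Exists.prems by (intro Exists.IH) auto
  then show ?case by simp
qed

lemma trm_val_in_univ:
  assumes "is_structure L M" "range e \<subseteq> univ M" "wf_trm L t"
  shows "trm_val M e t \<in> univ M"
  using assms(3)
proof (induction t)
  case (Var x)
  then show ?case using assms(2) by auto
next
  case (App f ts)
  then have "map (trm_val M e) ts \<in> tuples (univ M) (farity L f)"
    by (auto simp: tuples_def list_all_iff)
  then show ?case using App.prems assms(1) by (auto simp: is_structure_def)
qed

lemma holds_sentence_iff:
  assumes "\<phi> \<in> sentences L" "range e \<subseteq> univ M"
  shows "holds M \<phi> \<longleftrightarrow> sat M e \<phi>"
  using assms sat_cong[of \<phi> e] unfolding holds_def sentences_def by blast

lemma ex_assignment: "is_structure L M \<Longrightarrow> \<exists>e :: nat \<Rightarrow> 'a. range e \<subseteq> univ (M :: ('f, 'r, 'a) struct)"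
  by (auto simp: is_structure_def intro!: exI[of _ "\<lambda>_. SOME x. x \<in> univ M"] some_in_eq[THEN iffD2])

text \<open>Source and target may have different element types, and the map need not be an
  inclusion. For a structure \<open>M\<close>, injectivity and preservation of the symbols are
  contained in the clause for atomic formulas.\<close>

definition elem_embedding ::
  "('f, 'r) lang \<Rightarrow> ('f, 'r, 'a) struct \<Rightarrow> ('f, 'r, 'b) struct \<Rightarrow> ('a \<Rightarrow> 'b) \<Rightarrow> bool" where
  "elem_embedding L M N h \<longleftrightarrow> h ` univ M \<subseteq> univ N \<and>
     (\<forall>\<phi>\<in>formulas L. \<forall>e. range e \<subseteq> univ M \<longrightarrow> (sat M e \<phi> \<longleftrightarrow> sat N (h \<circ> e) \<phi>))"

lemma elem_embedding_comp:
  assumes "elem_embedding L M N g" "elem_embedding L N P h"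
  shows "elem_embedding L M P (h \<circ> g)"
  unfolding elem_embedding_def
proof (intro conjI ballI allI impI)
  show "(h \<circ> g) ` univ M \<subseteq> univ P" using assms by (fastforce simp: elem_embedding_def)
  fix \<phi> and e :: "nat \<Rightarrow> _" assume *: "\<phi> \<in> formulas L" "range e \<subseteq> univ M"
  moreover from this have "range (g \<circ> e) \<subseteq> univ N" using assms(1) by (fastforce simp: elem_embedding_def)
  ultimately show "sat M e \<phi> \<longleftrightarrow> sat P (h \<circ> g \<circ> e) \<phi>"
    using assms by (simp add: elem_embedding_def comp_assoc)
qed

lemma elem_embedding_imp_elem_equiv:
  assumes "is_structure L M" "elem_embedding L M N h"
  shows "elem_equiv L M N"
  unfolding elem_equiv_def
proof
  fix \<phi> assume \<phi>: "\<phi> \<in> sentences L"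
  obtain e :: "nat \<Rightarrow> 'c" where e: "range e \<subseteq> univ M" using ex_assignment[OF assms(1)] by blast
  then have "range (h \<circ> e) \<subseteq> univ N" using assms(2) by (fastforce simp: elem_embedding_def)
  then show "holds M \<phi> = holds N \<phi>"
    using assms(2) e \<phi> holds_sentence_iff[OF \<phi>, of e M] holds_sentence_iff[OF \<phi>, of "h \<circ> e" N]
    by (simp add: elem_embedding_def sentences_def comp_def)
qed

lemma elem_equiv_sym: "elem_equiv L M N \<Longrightarrow> elem_equiv L N M"
  by (auto simp: elem_equiv_def)

lemma elem_equiv_trans: "elem_equiv L M N \<Longrightarrow> elem_equiv L N P \<Longrightarrow> elem_equiv L M P"
  by (auto simp: elem_equiv_def)

lemma is_model_complete_theory_iff:
  fixes M :: "('f, 'r, 'c) struct" and N :: "('f, 'r, 'd) struct"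
  assumes "is_structure L M"
  shows "is_model L (complete_theory L M) N \<longleftrightarrow> is_structure L N \<and> elem_equiv L N M"
proof
  assume *: "is_model L (complete_theory L M) N"
  then have N: "is_structure L N" by (simp add: is_model_def)
  obtain d :: "nat \<Rightarrow> 'c" where d: "range d \<subseteq> univ M" using ex_assignment[OF assms(1)] by blast
  obtain e :: "nat \<Rightarrow> 'd" where e: "range e \<subseteq> univ N" using ex_assignment[OF N] by blast
  have "holds N \<phi> \<longleftrightarrow> holds M \<phi>" if \<phi>: "\<phi> \<in> sentences L" for \<phi>
  proof -
    \<comment> \<open>Completeness enters here: a sentence false in \<open>M\<close> has its
      negation in the theory, so \<open>N\<close> cannot satisfy more sentences than
      \<open>M\<close>.\<close>
    have neg: "Neg \<phi> \<in> sentences L" using \<phi> by (auto simp: sentences_def formulas_def)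
    have "holds N \<phi>" if "holds M \<phi>" using * that \<phi> by (auto simp: is_model_def complete_theory_def)
    moreover have "holds N (Neg \<phi>)" if "holds M (Neg \<phi>)"
      using * that neg by (auto simp: is_model_def complete_theory_def)
    ultimately show ?thesis
      using holds_sentence_iff[OF \<phi> d] holds_sentence_iff[OF \<phi> e]
        holds_sentence_iff[OF neg d] holds_sentence_iff[OF neg e] by auto
  qed
  then show "is_structure L N \<and> elem_equiv L N M" using N by (auto simp: elem_equiv_def)
qed (auto simp: is_model_def complete_theory_def elem_equiv_def)

lemma embedding_trm_val:
  assumes "is_structure L M" "embedding L M N h" "range e \<subseteq> univ M" "wf_trm L t"
  shows "h (trm_val M e t) = trm_val N (h \<circ> e) t"
  using assms(4)
proof (induction t)
  case (App f ts)
  have "map (trm_val M e) ts \<in> tuples (univ M) (farity L f)"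
    using App.prems trm_val_in_univ[OF assms(1,3)] by (auto simp: tuples_def list_all_iff)
  then have "h (trm_val M e (App f ts)) = fint N f (map h (map (trm_val M e) ts))"
    using App.prems assms(2) by (simp add: embedding_def)
  also have "map h (map (trm_val M e) ts) = map (trm_val N (h \<circ> e)) ts"
    using App by (auto simp: list_all_iff comp_def)
  finally show ?case by (simp add: comp_def)
qed auto

text \<open>Atomic formulas need only the embedding. Surjectivity enters at the quantifier, where a
  witness in \<open>N\<close> has to be the image of one in \<open>M\<close>.\<close>

lemma isomorphism_elem_embedding:
  assumes M: "is_structure L M" and h: "embedding L M N h" and surj: "h ` univ M = univ N"
  shows "elem_embedding L M N h"
proof -
  have "sat M e \<phi> \<longleftrightarrow> sat N (h \<circ> e) \<phi>" if "wf_fm L \<phi>" "range e \<subseteq> univ M" for \<phi> e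
    using that
  proof (induction \<phi> arbitrary: e)
    case (Eq s t)
    have "trm_val M e s \<in> univ M" "trm_val M e t \<in> univ M"
      using Eq trm_val_in_univ[OF M] by auto
    then have "sat M e (Eq s t) \<longleftrightarrow> h (trm_val M e s) = h (trm_val M e t)"
      using h by (auto simp: embedding_def inj_on_def)
    then show ?case using Eq embedding_trm_val[OF M h, of e] by (simp add: comp_def)
  next
    case (Rel r ts)
    have "map (trm_val M e) ts \<in> tuples (univ M) (rarity L r)"
      using Rel.prems trm_val_in_univ[OF M] by (auto simp: tuples_def list_all_iff)
    then have "sat M e (Rel r ts) \<longleftrightarrow> rint N r (map h (map (trm_val M e) ts))"
      using Rel.prems h by (simp add: embedding_def)
    also have "map h (map (trm_val M e) ts) = map (trm_val N (h \<circ> e)) ts"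
      using Rel.prems embedding_trm_val[OF M h, of e] by (auto simp: list_all_iff comp_def)
    finally show ?case by (simp add: comp_def)
  next
    case (Exists x \<phi>)
    have "sat M (e(x := a)) \<phi> \<longleftrightarrow> sat N ((h \<circ> e)(x := h a)) \<phi>" if "a \<in> univ M" for a
    proof -
      have "range (e(x := a)) \<subseteq> univ M" using Exists.prems that by auto
      then have "sat M (e(x := a)) \<phi> \<longleftrightarrow> sat N (h \<circ> e(x := a)) \<phi>"
        using Exists.prems(1) by (intro Exists.IH) simp_all
      then show ?thesis by (simp only: fun_upd_comp)
    qed
    then show ?case unfolding sat.simps surj[symmetric] by blast
  qed auto
  then show ?thesis using surj by (auto simp: elem_embedding_def formulas_def)
qed

lemma embedding_comp:
  assumes "embedding L M N g" "embedding L N P h"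
  shows "embedding L M P (h \<circ> g)"
proof -
  have tup: "map g xs \<in> tuples (univ N) k" if "xs \<in> tuples (univ M) k" for xs k
    using that assms(1) by (auto simp: embedding_def tuples_def)
  have "inj_on h (g ` univ M)" using assms by (auto simp: embedding_def intro: inj_on_subset)
  then show ?thesis using assms tup by (force simp: embedding_def intro: comp_inj_on)
qed

lemma embedding_inv_into:
  assumes M: "is_structure L M" and h: "embedding L M N h" and surj: "h ` univ M = univ N"
  shows "embedding L N M (inv_into (univ M) h)"
proof -
  let ?g = "inv_into (univ M) h"
  have inj: "inj_on h (univ M)" using h by (simp add: embedding_def)
  have g: "?g y \<in> univ M" "h (?g y) = y" if "y \<in> univ N" for y
    using that surj by (auto intro: inv_into_into f_inv_into_f)
  have tup: "map ?g ys \<in> tuples (univ M) k" "map h (map ?g ys) = ys" if "ys \<in> tuples (univ N) k" for ys k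
    using that g by (auto simp: tuples_def subset_iff intro!: map_idI)
  have "?g (fint N f ys) = fint M f (map ?g ys)"
    if f: "f \<in> fsyms L" and ys: "ys \<in> tuples (univ N) (farity L f)" for f ys
  proof -
    have "h (fint M f (map ?g ys)) = fint N f ys"
      using h f tup[OF ys] by (metis embedding_def)
    moreover have "fint M f (map ?g ys) \<in> univ M" using M f tup[OF ys] by (auto simp: is_structure_def)
    ultimately show ?thesis using inv_into_f_f[OF inj] by metis
  qed
  moreover have "rint N r ys \<longleftrightarrow> rint M r (map ?g ys)"
    if r: "r \<in> rsyms L" and ys: "ys \<in> tuples (univ N) (rarity L r)" for r ys
    using h r tup[OF ys] by (metis embedding_def)
  ultimately show ?thesis
    using g inj_on_inv_into[of "univ N" h "univ M"] surj by (auto simp: embedding_def)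
qed


section \<open>The downward Loewenheim-Skolem theorem\<close>

text \<open>\<open>X\<close> is closed under chosen witnesses for all formulas with parameters. Each
  of the countably many rounds keeps the size within \<open>formulas L\<close>, and the union passes
  the Tarski-Vaught test.\<close>

lemma downward_Loewenheim_Skolem:
  fixes L :: "('f, 'r) lang" and M :: "('f, 'r, 'a) struct"
  assumes M: "is_structure L M" and X: "X \<subseteq> univ M" "X \<lesssim> formulas L"
  shows "\<exists>C. X \<subseteq> C \<and> C \<subseteq> univ M \<and> C \<lesssim> formulas L \<and> is_structure L (M\<lparr>univ := C\<rparr>) \<and>
           elem_embedding L (M\<lparr>univ := C\<rparr>) M (\<lambda>x. x)"
proof -
  obtain d where d: "d \<in> univ M" using M by (auto simp: is_structure_def)
  \<comment> \<open>A finite list of parameters stands for an assignment; \<open>d\<close> fills the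
    indices beyond its end.\<close>
  define asg where "asg as i = (if i < length as then as ! i else d)" for as i
  define P where "P \<phi> v as b \<longleftrightarrow> b \<in> univ M \<and> sat M ((asg as)(v := b)) \<phi>" for \<phi> :: "('f, 'r) fm" and v as b
  define wit where "wit \<phi> v as = (if Ex (P \<phi> v as) then SOME b. P \<phi> v as b else d)"
    for \<phi> :: "('f, 'r) fm" and v as
  have wit: "P \<phi> v as (wit \<phi> v as)" if "P \<phi> v as b" for \<phi> v as b
    using that someI[of "P \<phi> v as"] by (auto simp: wit_def)
  have wit_univ: "wit \<phi> v as \<in> univ M" for \<phi> v as
    using d wit[of \<phi> v as] by (cases "Ex (P \<phi> v as)") (auto simp: wit_def P_def)
  define S where "S C = C \<union> (\<lambda>(\<phi>, v, as). wit \<phi> v as) ` (formulas L \<times> UNIV \<times> lists C)" for C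
  define C where "C n = (S ^^ n) (insert d X)" for n
  have C0: "C 0 = insert d X" and CSuc: "C (Suc n) = S (C n)" for n by (auto simp: C_def)
  have mono: "C n \<subseteq> C m" if "n \<le> m" for n m
    using that by (induction rule: dec_induct) (auto simp: CSuc S_def)
  have sub: "C n \<subseteq> univ M" for n
    by (induction n) (use X d wit_univ in \<open>auto simp: C0 CSuc S_def\<close>)
  have nat: "(UNIV :: nat set) \<lesssim> formulas L"
    using infinite_formulas infinite_le_lepoll by blast
  have card: "C n \<lesssim> formulas L" for n
  proof (induction n)
    case 0
    have "{d} \<union> X \<lesssim> formulas L"
      using X infinite_formulas by (intro Un_lepoll_infinite) (auto intro: finite_lepoll_infinite)
    then show ?case by (simp add: C0)
  next
    case (Suc n)
    have "(\<lambda>(\<phi>, v, as). wit \<phi> v as) ` (formulas L \<times> UNIV \<times> lists (C n)) \<lesssim> formulas L"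
      by (intro lepoll_trans[OF image_lepoll] Times_lepoll_infinite lists_lepoll_infinite
          infinite_formulas nat Suc lepoll_refl)
    then show ?case unfolding CSuc S_def by (intro Un_lepoll_infinite infinite_formulas Suc)
  qed
  define D where "D = (\<Union>n. C n)"
  have D_sub: "D \<subseteq> univ M" using sub by (auto simp: D_def)
  have D_card: "D \<lesssim> formulas L"
    unfolding D_def by (intro UN_lepoll_infinite infinite_formulas nat card)
  have ex_stage: "\<exists>n. set as \<subseteq> C n" if "set as \<subseteq> D" for as
    using that
  proof (induction as)
    case (Cons a as)
    then obtain n m where "set as \<subseteq> C n" "a \<in> C m" by (auto simp: D_def)
    then have "set (a # as) \<subseteq> C (max n m)" using mono[of n "max n m"] mono[of m "max n m"] by auto
    then show ?case by blast
  qed auto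
  have D_wit: "wit \<phi> v as \<in> D" if \<phi>: "\<phi> \<in> formulas L" and as: "set as \<subseteq> D" for \<phi> v as
  proof -
    obtain n where "set as \<subseteq> C n" using ex_stage[OF as] by blast
    then have "wit \<phi> v as \<in> C (Suc n)" using \<phi> by (force simp: CSuc S_def)
    then show ?thesis by (auto simp: D_def)
  qed
  have dD: "d \<in> D" and XD: "X \<subseteq> D" using C0 by (auto simp: D_def)
  have struct: "is_structure L (M\<lparr>univ := D\<rparr>)"
    unfolding is_structure_def
  proof (intro conjI ballI)
    show "univ (M\<lparr>univ := D\<rparr>) \<noteq> {}" using dD by auto
    fix f xs assume f: "f \<in> fsyms L" and xs: "xs \<in> tuples (univ (M\<lparr>univ := D\<rparr>)) (farity L f)"
    \<comment> \<open>Closure under functions is a case of closure under witnesses: the only witness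
      for variable 0 in this equation is the value of \<open>f\<close>. The arguments sit at indices
      1 and up, so the parameter list starts with a dummy \<open>d\<close> at index 0, which the
      witness overwrites.\<close>
    let ?\<phi> = "Eq (App f (map Var [1..<Suc (farity L f)])) (Var 0) :: ('f, 'r) fm"
    have \<phi>: "?\<phi> \<in> formulas L" using f by (auto simp: formulas_def list_all_iff)
    have xs': "set xs \<subseteq> D" "length xs = farity L f" using xs by (auto simp: tuples_def)
    have fin: "fint M f xs \<in> univ M" using M f xs' D_sub by (auto simp: is_structure_def tuples_def)
    have map: "map (\<lambda>i. ((asg (d # xs))(0 := b)) i) [1..<Suc (farity L f)] = xs" for b
      using xs'(2) by (auto intro!: nth_equalityI simp: asg_def simp del: upt_Suc)
    have P_iff: "P ?\<phi> 0 (d # xs) b \<longleftrightarrow> b \<in> univ M \<and> fint M f xs = b" for b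
      using map[of b] by (simp add: P_def comp_def del: upt_Suc)
    have "wit ?\<phi> 0 (d # xs) = fint M f xs"
      using P_iff wit[of ?\<phi> 0 "d # xs" "fint M f xs"] fin by auto
    then show "fint (M\<lparr>univ := D\<rparr>) f xs \<in> univ (M\<lparr>univ := D\<rparr>)"
      using D_wit[OF \<phi>, of "d # xs" 0] xs' dD by auto
  qed
  have trm: "trm_val (M\<lparr>univ := D\<rparr>) e t = trm_val M e t" for e t
    by (induction t) (auto cong: map_cong)
  have "sat (M\<lparr>univ := D\<rparr>) e \<phi> \<longleftrightarrow> sat M e \<phi>" if "wf_fm L \<phi>" "range e \<subseteq> D" for \<phi> e
    using that
  proof (induction \<phi> arbitrary: e)
    case (Exists x \<phi>)
    have IH: "sat (M\<lparr>univ := D\<rparr>) (e(x := a)) \<phi> \<longleftrightarrow> sat M (e(x := a)) \<phi>" if "a \<in> D" for a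
      using that Exists.prems by (intro Exists.IH) auto
    have "\<exists>a\<in>D. sat M (e(x := a)) \<phi>" if a: "a \<in> univ M" "sat M (e(x := a)) \<phi>" for a
    proof -
      \<comment> \<open>Finitely many variables are free, so an initial segment of the values of
        \<open>e\<close> provides enough parameters.\<close>
      obtain m where m: "\<forall>i\<in>fv \<phi>. i < m"
        using finite_fv[of \<phi>] finite_nat_set_iff_bounded by blast
      define as where "as = map e [0..<m]"
      have cong: "sat M ((asg as)(x := b)) \<phi> \<longleftrightarrow> sat M (e(x := b)) \<phi>" for b
        using m by (intro sat_cong) (auto simp: asg_def as_def)
      have "P \<phi> x as a" using a cong by (simp add: P_def)
      from wit[OF this] have "sat M (e(x := wit \<phi> x as)) \<phi>" using cong by (simp add: P_def)
      moreover have "wit \<phi> x as \<in> D"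
        using Exists.prems by (intro D_wit) (auto simp: as_def formulas_def)
      ultimately show ?thesis by blast
    qed
    then show ?case using IH D_sub by auto
  qed (simp_all add: trm cong: map_cong)
  then have "elem_embedding L (M\<lparr>univ := D\<rparr>) M (\<lambda>x. x)"
    using D_sub by (auto simp: elem_embedding_def formulas_def comp_def)
  then show ?thesis using XD D_sub D_card struct by blast
qed

section \<open>Finite products\<close>

lemma univ_product: "univ (product I M) = (\<Pi>\<^sub>E i\<in>I. univ (M i))"
  and fint_product: "fint (product I M) f xs = (\<lambda>i\<in>I. fint (M i) f (map (\<lambda>x. x i) xs))"
  and rint_product: "rint (product I M) r xs \<longleftrightarrow> (\<forall>i\<in>I. rint (M i) r (map (\<lambda>x. x i) xs))"
  by (simp_all add: product_def)

lemma is_structure_product: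
  assumes "\<And>i. i \<in> I \<Longrightarrow> is_structure L (M i)"
  shows "is_structure L (product I M)"
  unfolding is_structure_def
proof (intro conjI ballI)
  show "univ (product I M) \<noteq> {}"
    using assms by (auto simp: univ_product PiE_eq_empty_iff is_structure_def)
  fix f xs assume f: "f \<in> fsyms L" and xs: "xs \<in> tuples (univ (product I M)) (farity L f)"
  have "map (\<lambda>x. x i) xs \<in> tuples (univ (M i)) (farity L f)" if "i \<in> I" for i
    using xs that by (auto simp: tuples_def univ_product)
  then show "fint (product I M) f xs \<in> univ (product I M)"
    using assms f by (auto simp: univ_product fint_product is_structure_def)
qed

lemma trm_val_product:
  assumes "range e \<subseteq> univ (product I M)"
  shows "trm_val (product I M) e t = (\<lambda>i\<in>I. trm_val (M i) (\<lambda>k. e k i) t)"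
proof (induction t)
  case (Var x)
  have "e x \<in> extensional I" using assms by (auto simp: univ_product subset_iff PiE_iff)
  then show ?case by (auto simp: extensional_restrict)
next
  case (App f ts)
  have "map (\<lambda>x. x i) (map (trm_val (product I M) e) ts) = map (trm_val (M i) (\<lambda>k. e k i)) ts"
    if "i \<in> I" for i
    using that App by auto
  then show ?case unfolding trm_val.simps fint_product by (intro restrict_ext) (simp only:)
qed

text \<open>A finite set \<open>R\<close> of families of formulas stands for the disjunction over \<open>\<rho> \<in> R\<close> of the
  conditions that \<open>\<rho> i\<close> holds in the \<open>i\<close>-th factor for all \<open>i\<close>.\<close>

lemma neg_rectangles:
  fixes I :: "'i set" and L :: "('f, 'r) lang"
  assumes "finite I" "finite R" "\<And>\<rho> i. \<rho> \<in> R \<Longrightarrow> i \<in> I \<Longrightarrow> \<rho> i \<in> formulas L"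
  shows "\<exists>R'. finite R' \<and> (\<forall>\<rho>\<in>R'. \<forall>i\<in>I. \<rho> i \<in> formulas L) \<and>
    (\<forall>(M :: 'i \<Rightarrow> ('f, 'r, 'a) struct) es.
       (\<exists>\<rho>\<in>R'. \<forall>i\<in>I. sat (M i) (es i) (\<rho> i)) \<longleftrightarrow> \<not> (\<exists>\<rho>\<in>R. \<forall>i\<in>I. sat (M i) (es i) (\<rho> i)))"
  using assms(2,3)
proof (induction R rule: finite_induct)
  case empty
  show ?case
    \<comment> \<open>The empty disjunction is false; its negation is given by a family of formulas
      that always hold.\<close>
    by (rule exI[of _ "{\<lambda>_. Eq (Var 0) (Var 0)}"]) (auto simp: formulas_def)
next
  case (insert \<rho> R)
  then obtain R' where R': "finite R'" "\<forall>\<rho>\<in>R'. \<forall>i\<in>I. \<rho> i \<in> formulas L"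
    "\<And>(M :: 'i \<Rightarrow> ('f, 'r, 'a) struct) es.
       (\<exists>\<rho>\<in>R'. \<forall>i\<in>I. sat (M i) (es i) (\<rho> i)) \<longleftrightarrow> \<not> (\<exists>\<rho>\<in>R. \<forall>i\<in>I. sat (M i) (es i) (\<rho> i))"
    by auto
  \<comment> \<open>De Morgan and distributivity: \<rho> fails exactly if it fails at some
    coordinate \<open>j\<close>, and this is conjoined with each disjunct of the negation of
    \<open>R\<close>. At the other coordinates a trivial equation imposes nothing.\<close>
  let ?neg = "\<lambda>j \<rho>' i. And (if i = j then Neg (\<rho> i) else Eq (Var 0) (Var 0)) (\<rho>' i)"
  let ?R = "(\<lambda>(j, \<rho>'). ?neg j \<rho>') ` (I \<times> R')"
  have "(\<exists>\<rho>\<in>?R. \<forall>i\<in>I. sat (M i) (es i) (\<rho> i)) \<longleftrightarrow>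
      \<not> (\<exists>\<rho>\<in>insert \<rho> R. \<forall>i\<in>I. sat (M i) (es i) (\<rho> i))" for M :: "'i \<Rightarrow> ('f, 'r, 'a) struct" and es
  proof -
    have "(\<forall>i\<in>I. sat (M i) (es i) (?neg j \<rho>' i)) \<longleftrightarrow>
        \<not> sat (M j) (es j) (\<rho> j) \<and> (\<forall>i\<in>I. sat (M i) (es i) (\<rho>' i))" if "j \<in> I" for j \<rho>'
      using that by auto
    then have "(\<exists>\<rho>\<in>?R. \<forall>i\<in>I. sat (M i) (es i) (\<rho> i)) \<longleftrightarrow>
        (\<exists>j\<in>I. \<not> sat (M j) (es j) (\<rho> j)) \<and> (\<exists>\<rho>\<in>R'. \<forall>i\<in>I. sat (M i) (es i) (\<rho> i))"
      by (simp del: sat.simps)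
    then show ?thesis using R'(3) by auto
  qed
  moreover have "\<forall>\<rho>\<in>?R. \<forall>i\<in>I. \<rho> i \<in> formulas L"
    using R'(2) insert.prems by (auto simp: formulas_def)
  moreover have "finite ?R" using assms(1) R'(1) by auto
  ultimately show ?case by blast
qed

text \<open>Finite unions of such conditions contain the atomic formulas and are closed under
  negation, conjunction and quantification. The set \<open>R\<close> depends on \<phi> and
  \<open>I\<close> but not on the factors, which is what lets it be compared in two
  products.\<close>

lemma Feferman_Vaught_finite:
  fixes I :: "'i set" and L :: "('f, 'r) lang"
  assumes I: "finite I" and "\<phi> \<in> formulas L"
  shows "\<exists>R. finite R \<and> (\<forall>\<rho>\<in>R. \<forall>i\<in>I. \<rho> i \<in> formulas L) \<and>
    (\<forall>(M :: 'i \<Rightarrow> ('f, 'r, 'a) struct) e. range e \<subseteq> univ (product I M) \<longrightarrow>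
       (sat (product I M) e \<phi> \<longleftrightarrow> (\<exists>\<rho>\<in>R. \<forall>i\<in>I. sat (M i) (\<lambda>k. e k i) (\<rho> i))))"
proof -
  have "wf_fm L \<phi>" using assms(2) by (simp add: formulas_def)
  then show ?thesis
  proof (induction \<phi>)
    case (Eq s t)
    have "sat (product I M) e (Eq s t) \<longleftrightarrow> (\<forall>i\<in>I. sat (M i) (\<lambda>k. e k i) (Eq s t))"
      if "range e \<subseteq> univ (product I M)" for M :: "'i \<Rightarrow> ('f, 'r, 'a) struct" and e
      by (auto simp: trm_val_product[OF that] fun_eq_iff)
    then show ?case using Eq by (intro exI[of _ "{\<lambda>_. Eq s t}"]) (auto simp: formulas_def)
  next
    case (Rel r ts)
    have "sat (product I M) e (Rel r ts) \<longleftrightarrow> (\<forall>i\<in>I. sat (M i) (\<lambda>k. e k i) (Rel r ts))"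
      if "range e \<subseteq> univ (product I M)" for M :: "'i \<Rightarrow> ('f, 'r, 'a) struct" and e
      by (simp add: trm_val_product[OF that] rint_product comp_def cong: map_cong)
    then show ?case using Rel by (intro exI[of _ "{\<lambda>_. Rel r ts}"]) (auto simp: formulas_def)
  next
    case (Neg \<phi>)
    then obtain R where R: "finite R" "\<forall>\<rho>\<in>R. \<forall>i\<in>I. \<rho> i \<in> formulas L"
      "\<And>(M :: 'i \<Rightarrow> ('f, 'r, 'a) struct) e. range e \<subseteq> univ (product I M) \<Longrightarrow>
         (sat (product I M) e \<phi> \<longleftrightarrow> (\<exists>\<rho>\<in>R. \<forall>i\<in>I. sat (M i) (\<lambda>k. e k i) (\<rho> i)))"
      by auto
    obtain R' where R': "finite R'" "\<forall>\<rho>\<in>R'. \<forall>i\<in>I. \<rho> i \<in> formulas L"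
      "\<And>(M :: 'i \<Rightarrow> ('f, 'r, 'a) struct) es.
         (\<exists>\<rho>\<in>R'. \<forall>i\<in>I. sat (M i) (es i) (\<rho> i)) \<longleftrightarrow> \<not> (\<exists>\<rho>\<in>R. \<forall>i\<in>I. sat (M i) (es i) (\<rho> i))"
      using neg_rectangles[where 'a = 'a, OF I R(1), of L] R(2) by auto
    show ?case by (rule exI[of _ R']) (simp add: R R')
  next
    case (And \<phi> \<psi>)
    from And obtain R where R: "finite R" "\<forall>\<rho>\<in>R. \<forall>i\<in>I. \<rho> i \<in> formulas L"
      "\<And>(M :: 'i \<Rightarrow> ('f, 'r, 'a) struct) e. range e \<subseteq> univ (product I M) \<Longrightarrow>
         (sat (product I M) e \<phi> \<longleftrightarrow> (\<exists>\<rho>\<in>R. \<forall>i\<in>I. sat (M i) (\<lambda>k. e k i) (\<rho> i)))"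
      by auto
    from And obtain R' where R': "finite R'" "\<forall>\<rho>\<in>R'. \<forall>i\<in>I. \<rho> i \<in> formulas L"
      "\<And>(M :: 'i \<Rightarrow> ('f, 'r, 'a) struct) e. range e \<subseteq> univ (product I M) \<Longrightarrow>
         (sat (product I M) e \<psi> \<longleftrightarrow> (\<exists>\<rho>\<in>R'. \<forall>i\<in>I. sat (M i) (\<lambda>k. e k i) (\<rho> i)))"
      by auto
    let ?R = "(\<lambda>(\<rho>, \<rho>') i. And (\<rho> i) (\<rho>' i)) ` (R \<times> R')"
    have fin: "finite ?R" and wf: "\<forall>\<rho>\<in>?R. \<forall>i\<in>I. \<rho> i \<in> formulas L"
      using R R' by (auto simp: formulas_def)
    have eq: "sat (product I M) e (And \<phi> \<psi>) \<longleftrightarrow> (\<exists>\<rho>\<in>?R. \<forall>i\<in>I. sat (M i) (\<lambda>k. e k i) (\<rho> i))"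
      if "range e \<subseteq> univ (product I M)" for M :: "'i \<Rightarrow> ('f, 'r, 'a) struct" and e
      using R(3)[OF that] R'(3)[OF that] by (simp add: ball_conj_distrib)
    show ?case by (intro exI[of _ ?R] conjI allI impI fin wf eq)
  next
    case (Exists x \<phi>)
    then obtain R where R: "finite R" "\<forall>\<rho>\<in>R. \<forall>i\<in>I. \<rho> i \<in> formulas L"
      "\<And>(M :: 'i \<Rightarrow> ('f, 'r, 'a) struct) e. range e \<subseteq> univ (product I M) \<Longrightarrow>
         (sat (product I M) e \<phi> \<longleftrightarrow> (\<exists>\<rho>\<in>R. \<forall>i\<in>I. sat (M i) (\<lambda>k. e k i) (\<rho> i)))"
      by auto
    let ?R = "(\<lambda>\<rho> i. Exists x (\<rho> i)) ` R"
    have fin: "finite ?R" and wf: "\<forall>\<rho>\<in>?R. \<forall>i\<in>I. \<rho> i \<in> formulas L"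
      using R by (auto simp: formulas_def)
    have eq: "sat (product I M) e (Exists x \<phi>) \<longleftrightarrow> (\<exists>\<rho>\<in>?R. \<forall>i\<in>I. sat (M i) (\<lambda>k. e k i) (\<rho> i))"
      if e: "range e \<subseteq> univ (product I M)" for M :: "'i \<Rightarrow> ('f, 'r, 'a) struct" and e
    proof -
      have upd: "(\<lambda>k. (e(x := a)) k i) = (\<lambda>k. e k i)(x := a i)" for a i by auto
      \<comment> \<open>An element of the product is an independent choice of its coordinates, so
        the quantifier distributes over the factors.\<close>
      have choice: "(\<exists>a\<in>univ (product I M). \<forall>i\<in>I. sat (M i) ((\<lambda>k. e k i)(x := a i)) (\<rho> i)) \<longleftrightarrow>
          (\<forall>i\<in>I. \<exists>b\<in>univ (M i). sat (M i) ((\<lambda>k. e k i)(x := b)) (\<rho> i))" for \<rho>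
      proof
        assume "\<forall>i\<in>I. \<exists>b\<in>univ (M i). sat (M i) ((\<lambda>k. e k i)(x := b)) (\<rho> i)"
        then obtain a where "\<forall>i\<in>I. a i \<in> univ (M i) \<and> sat (M i) ((\<lambda>k. e k i)(x := a i)) (\<rho> i)"
          by metis
        then show "\<exists>a\<in>univ (product I M). \<forall>i\<in>I. sat (M i) ((\<lambda>k. e k i)(x := a i)) (\<rho> i)"
          by (intro bexI[of _ "restrict a I"]) (auto simp: univ_product)
      qed (auto simp: univ_product)
      have "sat (product I M) e (Exists x \<phi>) \<longleftrightarrow> (\<exists>a\<in>univ (product I M). \<exists>\<rho>\<in>R. \<forall>i\<in>I.
          sat (M i) ((\<lambda>k. e k i)(x := a i)) (\<rho> i))"
      proof -
        have "sat (product I M) (e(x := a)) \<phi> \<longleftrightarrow>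
            (\<exists>\<rho>\<in>R. \<forall>i\<in>I. sat (M i) ((\<lambda>k. e k i)(x := a i)) (\<rho> i))" if "a \<in> univ (product I M)" for a
        proof -
          have "range (e(x := a)) \<subseteq> univ (product I M)" using e that by auto
          from R(3)[OF this] show ?thesis unfolding upd .
        qed
        then show ?thesis by simp
      qed
      also have "\<dots> \<longleftrightarrow> (\<exists>\<rho>\<in>R. \<exists>a\<in>univ (product I M). \<forall>i\<in>I. sat (M i) ((\<lambda>k. e k i)(x := a i)) (\<rho> i))"
        by blast
      finally show ?thesis using choice by simp
    qed
    show ?case by (intro exI[of _ ?R] conjI allI impI fin wf eq)
  qed
qed

text \<open>The same \<open>R\<close> evaluates \<phi> in both products, and each of its component
  formulas is preserved by the corresponding \<open>h i\<close>. Both families have elements in one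
  type, since \<open>R\<close> is obtained for a fixed element type.\<close>

lemma elem_embedding_product_map:
  fixes A :: "'i \<Rightarrow> ('f, 'r, 'a) struct" and B :: "'i \<Rightarrow> ('f, 'r, 'a) struct"
  assumes I: "finite I" and h: "\<And>i. i \<in> I \<Longrightarrow> elem_embedding L (A i) (B i) (h i)"
  shows "elem_embedding L (product I A) (product I B) (product_map I h)"
  unfolding elem_embedding_def
proof (intro conjI ballI allI impI)
  have maps: "product_map I h x \<in> univ (product I B)" if "x \<in> univ (product I A)" for x
    using h that by (fastforce simp: product_map_def univ_product elem_embedding_def)
  then show "product_map I h ` univ (product I A) \<subseteq> univ (product I B)" by auto
  fix \<phi> and e :: "nat \<Rightarrow> 'i \<Rightarrow> 'a"
  assume \<phi>: "\<phi> \<in> formulas L" and e: "range e \<subseteq> univ (product I A)"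
  have e': "range (product_map I h \<circ> e) \<subseteq> univ (product I B)" using e maps by auto
  obtain R where R: "\<forall>\<rho>\<in>R. \<forall>i\<in>I. \<rho> i \<in> formulas L"
    "\<And>(M :: 'i \<Rightarrow> ('f, 'r, 'a) struct) e. range e \<subseteq> univ (product I M) \<Longrightarrow>
       (sat (product I M) e \<phi> \<longleftrightarrow> (\<exists>\<rho>\<in>R. \<forall>i\<in>I. sat (M i) (\<lambda>k. e k i) (\<rho> i)))"
    using Feferman_Vaught_finite[where 'a = 'a, OF I \<phi>] by blast
  have "sat (A i) (\<lambda>k. e k i) (\<rho> i) \<longleftrightarrow> sat (B i) (\<lambda>k. (product_map I h \<circ> e) k i) (\<rho> i)"
    if "\<rho> \<in> R" "i \<in> I" for \<rho> i
  proof -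
    have "range (\<lambda>k. e k i) \<subseteq> univ (A i)" using e \<open>i \<in> I\<close> by (auto simp: univ_product)
    moreover have "h i \<circ> (\<lambda>k. e k i) = (\<lambda>k. (product_map I h \<circ> e) k i)"
      using \<open>i \<in> I\<close> by (auto simp: product_map_def)
    ultimately show ?thesis using h[OF \<open>i \<in> I\<close>] R(1) that unfolding elem_embedding_def by metis
  qed
  then show "sat (product I A) e \<phi> \<longleftrightarrow> sat (product I B) (product_map I h \<circ> e) \<phi>"
    unfolding R(2)[OF e] R(2)[OF e'] by blast
qed

text \<open>The new \<open>j\<close>-th coordinate is the old one at \<tau> \<open>j\<close>, so the
  \<open>j\<close>-th factor of the target is \<open>M\<close> at \<tau> \<open>j\<close>.
  Reindexing a conjunction over \<open>I\<close> by a permutation does not change it.\<close>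

lemma coord_perm_isomorphism:
  assumes \<tau>: "\<tau> permutes I"
  shows "embedding L (product I M) (product I (M \<circ> \<tau>)) (coord_perm I \<tau>)"
    and "coord_perm I \<tau> ` univ (product I M) = univ (product I (M \<circ> \<tau>))"
proof -
  have \<tau>I: "\<tau> j \<in> I \<longleftrightarrow> j \<in> I" for j using \<tau> by (rule permutes_in_image)
  have all: "(\<forall>j\<in>I. Q (\<tau> j)) \<longleftrightarrow> (\<forall>i\<in>I. Q i)" for Q
    using permutes_image[OF \<tau>] by (metis image_iff)
  have inj: "inj_on (coord_perm I \<tau>) (univ (product I M))"
  proof
    fix x y assume x: "x \<in> univ (product I M)" and y: "y \<in> univ (product I M)"
      and "coord_perm I \<tau> x = coord_perm I \<tau> y"
    then have "\<forall>j\<in>I. x (\<tau> j) = y (\<tau> j)" by (metis coord_perm_def restrict_apply')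
    then have "\<forall>i\<in>I. x i = y i" using all[of "\<lambda>i. x i = y i"] by blast
    then show "x = y" using x y unfolding univ_product by (intro PiE_ext) auto
  qed
  have map: "map (\<lambda>x. x j) (map (coord_perm I \<tau>) xs) = map (\<lambda>x. x (\<tau> j)) xs" if "j \<in> I" for j and xs :: "('a \<Rightarrow> 'd) list"
    using that by (auto simp: coord_perm_def)
  have fint: "coord_perm I \<tau> (fint (product I M) f xs) = fint (product I (M \<circ> \<tau>)) f (map (coord_perm I \<tau>) xs)" for f xs
    unfolding fint_product using map by (auto simp: coord_perm_def \<tau>I fun_eq_iff simp del: map_map)
  have rint: "rint (product I M) r xs \<longleftrightarrow> rint (product I (M \<circ> \<tau>)) r (map (coord_perm I \<tau>) xs)" for r xs
    unfolding rint_product using map all[of "\<lambda>i. rint (M i) r (map (\<lambda>x. x i) xs)"] by (simp del: map_map)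
  have maps: "coord_perm I \<tau> ` univ (product I M) \<subseteq> univ (product I (M \<circ> \<tau>))"
    by (auto simp: univ_product coord_perm_def \<tau>I)
  then show "embedding L (product I M) (product I (M \<circ> \<tau>)) (coord_perm I \<tau>)"
    using inj fint rint by (simp add: embedding_def)
  have "y \<in> coord_perm I \<tau> ` univ (product I M)" if y: "y \<in> univ (product I (M \<circ> \<tau>))" for y
  proof (rule image_eqI)
    let ?x = "\<lambda>i\<in>I. y (inv \<tau> i)"
    have inv: "inv \<tau> i \<in> I \<longleftrightarrow> i \<in> I" "\<tau> (inv \<tau> i) = i" "inv \<tau> (\<tau> i) = i" for i
      using \<tau> permutes_in_image[OF permutes_inv[OF \<tau>]] by (auto simp: permutes_inverses)
    have "y (inv \<tau> i) \<in> univ (M i)" if "i \<in> I" for i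
    proof -
      have "y (inv \<tau> i) \<in> univ (M (\<tau> (inv \<tau> i)))"
        using y that inv(1)[of i] by (auto simp: univ_product PiE_iff)
      then show ?thesis using inv(2) by simp
    qed
    then show "?x \<in> univ (product I M)" by (auto simp: univ_product)
    show "y = coord_perm I \<tau> ?x"
      using y by (auto simp: coord_perm_def \<tau>I inv fun_eq_iff univ_product PiE_iff extensional_def)
  qed
  then show "coord_perm I \<tau> ` univ (product I M) = univ (product I (M \<circ> \<tau>))" using maps by blast
qed

section \<open>Iterated ultrafilter quantifiers\<close>

definition ultra :: "'i filter \<Rightarrow> bool" where
  "ultra D \<longleftrightarrow> D \<noteq> bot \<and> (\<forall>P. eventually P D \<or> eventually (\<lambda>s. \<not> P s) D)"

text \<open>A smaller filter has more eventual properties, so ultrafilters are the minimal proper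
  filters and Zorn's lemma is applied to the reversed order.\<close>

lemma ex_ultra:
  assumes "F \<noteq> bot"
  shows "\<exists>D. ultra D \<and> D \<le> F"
proof -
  let ?A = "{G. G \<noteq> bot \<and> G \<le> F}"
  have "\<exists>D\<in>?A. \<forall>G\<in>?A. G \<le> D \<longrightarrow> G = D"
  proof (rule predicate_Zorn[where P = "\<lambda>G H. H \<le> G"])
    show "partial_order_on ?A (relation_of (\<lambda>G H. H \<le> G) ?A)"
      by (rule partial_order_on_relation_ofI) auto
    fix C assume C: "C \<in> Chains (relation_of (\<lambda>G H. H \<le> G) ?A)"
    then have sub: "C \<subseteq> ?A" and chain: "\<And>G H. G \<in> C \<Longrightarrow> H \<in> C \<Longrightarrow> G \<le> H \<or> H \<le> G"
      by (auto simp: Chains_def relation_of_def)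
    show "\<exists>U\<in>?A. \<forall>G\<in>C. U \<le> G"
    proof (cases "C = {}")
      case False
      \<comment> \<open>A chain is a filter base: whatever holds eventually for its infimum already
        does for a member. Hence the infimum is proper.\<close>
      have "eventually P (Inf C) \<longleftrightarrow> (\<exists>G\<in>C. eventually P G)" for P
      proof (rule eventually_Inf_base[OF False])
        fix G H assume "G \<in> C" "H \<in> C"
        then show "\<exists>U\<in>C. U \<le> inf G H" using chain[of G H] by auto
      qed
      then have "Inf C \<noteq> bot"
        using sub trivial_limit_def by blast
      moreover have "Inf C \<le> F" using False sub by (metis (mono_tags, lifting) Inf_lower2 all_not_in_conv mem_Collect_eq subset_iff)
      ultimately show ?thesis by (auto intro: Inf_lower)
    qed (use assms in auto)
  qed
  then obtain D where D: "D \<noteq> bot" "D \<le> F" and max: "\<And>G. G \<noteq> bot \<Longrightarrow> G \<le> D \<Longrightarrow> G = D"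
    by (auto intro: order_trans)
  \<comment> \<open>Either \<open>P\<close> can be added to \<open>D\<close> without loss of
    properness, and then minimality puts it in \<open>D\<close>, or \<open>D\<close> already
    contains its negation.\<close>
  have "eventually P D \<or> eventually (\<lambda>s. \<not> P s) D" for P
  proof (cases "inf D (principal {s. P s}) = bot")
    case True
    then have "eventually (\<lambda>s. False) (inf D (principal {s. P s}))" by simp
    then show ?thesis by (simp add: eventually_inf_principal)
  next
    case False
    then have "inf D (principal {s. P s}) = D" by (intro max) auto
    then have "D \<le> principal {s. P s}" by (metis inf.cobounded2)
    then show ?thesis by (simp add: le_principal)
  qed
  then show ?thesis using D by (auto simp: ultra_def)
qed

lemma ultra_not_iff:
  assumes "ultra D"
  shows "eventually (\<lambda>s. \<not> P s) D \<longleftrightarrow> \<not> eventually P D"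
proof
  assume *: "eventually (\<lambda>s. \<not> P s) D"
  show "\<not> eventually P D"
  proof
    assume "eventually P D"
    with * have "eventually (\<lambda>s. False) D" by eventually_elim simp
    then show False using assms by (simp add: ultra_def trivial_limit_def)
  qed
qed (use assms in \<open>auto simp: ultra_def\<close>)

lemma ultra_const_iff: "ultra D \<Longrightarrow> eventually (\<lambda>s. P) D \<longleftrightarrow> P"
  unfolding ultra_def by (simp add: eventually_const_iff)

text \<open>The coordinate \<open>n\<close> is quantified outside of the coordinates below \<open>n\<close>: the \<open>n\<close>-th stage of
  the iteration is the ultrapower by \<open>D\<close> of the stage before it.\<close>

primrec iter_ev :: "'i filter \<Rightarrow> nat \<Rightarrow> ((nat \<Rightarrow> 'i) \<Rightarrow> bool) \<Rightarrow> (nat \<Rightarrow> 'i) \<Rightarrow> bool" where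
  "iter_ev D 0 P x \<longleftrightarrow> P x"
| "iter_ev D (Suc n) P x \<longleftrightarrow> eventually (\<lambda>s. iter_ev D n P (x(n := s))) D"

section \<open>Functions of finitely many coordinates and the limit quantifier\<close>

definition depends_below :: "nat \<Rightarrow> ((nat \<Rightarrow> 'i) \<Rightarrow> 'b) \<Rightarrow> bool" where
  "depends_below n f \<longleftrightarrow> (\<forall>x y. (\<forall>i<n. x i = y i) \<longrightarrow> f x = f y)"

definition fin_dep :: "((nat \<Rightarrow> 'i) \<Rightarrow> 'b) \<Rightarrow> bool" where
  "fin_dep f \<longleftrightarrow> (\<exists>n. depends_below n f)"

text \<open>The iterated quantifiers stabilize once all relevant coordinates are covered, so for an
  ultrafilter any bound \<open>n\<close> gives the same answer. Properties without such a bound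
  never hold in this sense; this is why closure rules carry \<open>fin_dep\<close> side
  conditions.\<close>

definition lim_ev :: "'i filter \<Rightarrow> ((nat \<Rightarrow> 'i) \<Rightarrow> bool) \<Rightarrow> bool" where
  "lim_ev D P \<longleftrightarrow> (\<exists>n. depends_below n P \<and> (\<forall>x. iter_ev D n P x))"

lemma depends_below_mono: "depends_below n f \<Longrightarrow> n \<le> m \<Longrightarrow> depends_below m f"
  by (auto simp: depends_below_def)

lemma depends_below_comp: "depends_below n f \<Longrightarrow> depends_below n (\<lambda>x. h (f x))"
  unfolding depends_below_def by metis

lemma depends_below_comp2:
  "depends_below n f \<Longrightarrow> depends_below n g \<Longrightarrow> depends_below n (\<lambda>x. h (f x) (g x))"
  unfolding depends_below_def by metis

lemma fin_dep_comp: "fin_dep f \<Longrightarrow> fin_dep (\<lambda>x. h (f x))"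
  using depends_below_comp unfolding fin_dep_def by fast

lemma fin_dep_common:
  assumes "finite V" "\<And>i. i \<in> V \<Longrightarrow> fin_dep (f i)"
  shows "\<exists>n. \<forall>i\<in>V. depends_below n (f i)"
proof -
  obtain n where n: "\<And>i. i \<in> V \<Longrightarrow> depends_below (n i) (f i)"
    using assms(2) unfolding fin_dep_def by metis
  have "n i \<le> Max (n ` V)" if "i \<in> V" for i using that assms(1) by simp
  then show ?thesis using n depends_below_mono by blast
qed

lemma fin_dep_comp2:
  assumes "fin_dep f" "fin_dep g"
  shows "fin_dep (\<lambda>x. h (f x) (g x))"
proof -
  obtain n m where "depends_below n f" "depends_below m g" using assms by (auto simp: fin_dep_def)
  then have "depends_below (max n m) f" "depends_below (max n m) g"
    by (auto intro: depends_below_mono)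
  from depends_below_comp2[OF this, of h] show ?thesis by (auto simp: fin_dep_def)
qed

lemma depends_below_map:
  assumes "\<And>f. f \<in> set fs \<Longrightarrow> depends_below n f"
  shows "depends_below n (\<lambda>x. map (\<lambda>f. f x) fs)"
  unfolding depends_below_def
proof (intro allI impI)
  fix x y :: "nat \<Rightarrow> 'a" assume "\<forall>i<n. x i = y i"
  then have "f x = f y" if "f \<in> set fs" for f
    using assms[OF that] unfolding depends_below_def by blast
  then show "map (\<lambda>f. f x) fs = map (\<lambda>f. f y) fs" by simp
qed

lemma fin_dep_map:
  assumes "\<And>f. f \<in> set fs \<Longrightarrow> fin_dep f"
  shows "fin_dep (\<lambda>x. map (\<lambda>f. f x) fs)"
proof -
  obtain n where "\<forall>f\<in>set fs. depends_below n f"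
    using fin_dep_common[of "set fs" "\<lambda>f. f"] assms by auto
  then have "depends_below n (\<lambda>x. map (\<lambda>f. f x) fs)" by (intro depends_below_map) auto
  then show ?thesis by (auto simp: fin_dep_def)
qed

text \<open>Only coordinates below \<open>n\<close> are quantified, so the implication is needed
  just at points that agree with \<open>x\<close> from \<open>n\<close> on. The saturation argument
  uses this to keep its new coordinate fixed.\<close>

lemma iter_ev_mono:
  assumes "iter_ev D n P x" "\<And>y. (\<And>i. n \<le> i \<Longrightarrow> y i = x i) \<Longrightarrow> P y \<Longrightarrow> Q y"
  shows "iter_ev D n Q x"
  using assms
proof (induction n arbitrary: x)
  case (Suc n)
  have "iter_ev D n Q (x(n := s))" if "iter_ev D n P (x(n := s))" for s
    using that by (rule Suc.IH) (use Suc.prems(2) in auto)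
  then show ?case using Suc.prems(1) by (auto elim: eventually_mono)
qed auto

lemma iter_ev_depends:
  assumes "depends_below m P" "\<And>i. n \<le> i \<Longrightarrow> i < m \<Longrightarrow> x i = y i"
  shows "iter_ev D n P x \<longleftrightarrow> iter_ev D n P y"
  using assms(2)
proof (induction n arbitrary: x y)
  case 0
  then show ?case using assms(1) by (simp add: depends_below_def)
next
  case (Suc n)
  have "iter_ev D n P (x(n := s)) \<longleftrightarrow> iter_ev D n P (y(n := s))" for s
    using Suc.prems by (intro Suc.IH) auto
  then show ?case by simp
qed

lemma iter_ev_ge:
  assumes "ultra D" "depends_below n P" "n \<le> m"
  shows "iter_ev D m P x \<longleftrightarrow> iter_ev D n P y"
  using assms(3)
proof (induction m arbitrary: x rule: dec_induct)
  case base
  show ?case using assms(2) by (rule iter_ev_depends) auto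
next
  case (step m)
  then show ?case using assms(1) by (simp add: ultra_const_iff)
qed

lemma lim_ev_iff:
  assumes "ultra D" "depends_below n P"
  shows "lim_ev D P \<longleftrightarrow> iter_ev D n P x"
proof
  assume "lim_ev D P"
  then obtain m where m: "depends_below m P" "\<And>x. iter_ev D m P x" by (auto simp: lim_ev_def)
  then show "iter_ev D n P x"
    using iter_ev_ge[OF assms(1) m(1), of "max m n"] iter_ev_ge[OF assms, of "max m n"] by auto
next
  assume *: "iter_ev D n P x"
  have "iter_ev D n P y" for y using * iter_ev_ge[OF assms order.refl, of x y] by auto
  then show "lim_ev D P" using assms by (auto simp: lim_ev_def)
qed

lemma lim_ev_fin_dep: "lim_ev D P \<Longrightarrow> fin_dep P"
  by (auto simp: lim_ev_def fin_dep_def)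

lemma lim_ev_True: "(\<And>x. P x) \<Longrightarrow> lim_ev D P"
  unfolding lim_ev_def by (rule exI[of _ 0]) (auto simp: depends_below_def)

lemma iter_ev_not: "ultra D \<Longrightarrow> iter_ev D n (\<lambda>x. \<not> P x) x \<longleftrightarrow> \<not> iter_ev D n P x"
  by (induction n arbitrary: x) (auto simp: ultra_not_iff)

lemma lim_ev_not:
  assumes "ultra D" "fin_dep P"
  shows "lim_ev D (\<lambda>x. \<not> P x) \<longleftrightarrow> \<not> lim_ev D P"
proof -
  obtain n where n: "depends_below n P" using assms by (auto simp: fin_dep_def)
  show ?thesis
    using lim_ev_iff[OF assms(1) n] lim_ev_iff[OF assms(1) depends_below_comp[OF n, of Not]]
      iter_ev_not[OF assms(1)] by auto
qed

lemma lim_ev_mono: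
  assumes "ultra D" "lim_ev D P" "fin_dep Q" "\<And>x. P x \<Longrightarrow> Q x"
  shows "lim_ev D Q"
proof -
  obtain n m where n: "depends_below n P" and m: "depends_below m Q"
    using lim_ev_fin_dep[OF assms(2)] assms(3) by (auto simp: fin_dep_def)
  have n': "depends_below (max n m) P" and m': "depends_below (max n m) Q"
    using n m by (auto intro: depends_below_mono)
  have "iter_ev D (max n m) P x" for x using assms(1,2) n' lim_ev_iff by blast
  then have "iter_ev D (max n m) Q x" for x by (rule iter_ev_mono) (use assms(4) in auto)
  then show ?thesis using m' by (auto simp: lim_ev_def)
qed

lemma iter_ev_conj:
  "iter_ev D n (\<lambda>x. P x \<and> Q x) x \<longleftrightarrow> iter_ev D n P x \<and> iter_ev D n Q x"
  by (induction n arbitrary: x) (auto simp: eventually_conj_iff)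

lemma lim_ev_conj:
  assumes "ultra D" "lim_ev D P" "lim_ev D Q"
  shows "lim_ev D (\<lambda>x. P x \<and> Q x)"
proof -
  obtain n m where "depends_below n P" "depends_below m Q"
    using assms(2,3) by (auto simp: lim_ev_def)
  then have n: "depends_below (max n m) P" and m: "depends_below (max n m) Q"
    by (auto intro: depends_below_mono)
  have "iter_ev D (max n m) P x" "iter_ev D (max n m) Q x" for x using assms n m lim_ev_iff by blast+
  then show ?thesis
    using depends_below_comp2[OF n m, of "(\<and>)"] unfolding lim_ev_def by (auto simp: iter_ev_conj)
qed

lemma lim_ev_conj_iff:
  assumes "ultra D" "fin_dep P" "fin_dep Q"
  shows "lim_ev D (\<lambda>x. P x \<and> Q x) \<longleftrightarrow> lim_ev D P \<and> lim_ev D Q"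
  using assms lim_ev_conj lim_ev_mono[OF assms(1) _ assms(2), of "\<lambda>x. P x \<and> Q x"]
    lim_ev_mono[OF assms(1) _ assms(3), of "\<lambda>x. P x \<and> Q x"] by blast

lemma lim_ev_ball_finite:
  assumes "ultra D" "finite S" "\<And>z. z \<in> S \<Longrightarrow> lim_ev D (P z)"
  shows "lim_ev D (\<lambda>x. \<forall>z\<in>S. P z x)"
  using assms(2,3)
proof (induction S rule: finite_induct)
  case (insert z S)
  then show ?case using lim_ev_conj[OF assms(1), of "P z"] by simp
qed (auto intro: lim_ev_True)

text \<open>Induction over the quantifiers still to be evaluated, with the invariant that the
  coordinates between \<open>k\<close> and \<open>n\<close> have already been put into
  \<open>I\<close>.\<close>

lemma iter_ev_concentrated:
  assumes "eventually (\<lambda>s. s \<in> I) D" "\<And>y. (\<And>i. i < n \<Longrightarrow> y i \<in> I) \<Longrightarrow> P y"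
  shows "iter_ev D n P x"
proof -
  have "iter_ev D k P x" if "k \<le> n" "\<And>i. k \<le> i \<Longrightarrow> i < n \<Longrightarrow> x i \<in> I" for k x
    using that
  proof (induction k arbitrary: x)
    case (Suc k)
    have "iter_ev D k P (x(k := s))" if "s \<in> I" for s
      using Suc.prems that by (intro Suc.IH) auto
    then show ?case using assms(1) by (auto elim: eventually_mono)
  qed (use assms(2) in auto)
  then show ?thesis by auto
qed


section \<open>Limit ultrapowers\<close>

text \<open>Functions that depend on the coordinates below \<open>n\<close> represent the elements
  of the \<open>n\<close>-th iterated ultrapower. Regarding them as functions of more coordinates is
  the diagonal embedding into later stages, so the direct limit becomes a plain union.\<close>

definition fin_dep_fun :: "'a set \<Rightarrow> ((nat \<Rightarrow> 'i) \<Rightarrow> 'a) set" where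
  "fin_dep_fun A = {f. fin_dep f \<and> range f \<subseteq> A}"

text \<open>\<open>rep\<close> names the classes of functions that agree almost everywhere by elements of the
  type \<open>'u\<close>, in which the limit ultrapower has to live.\<close>

locale limit_ultrapower =
  fixes D :: "'i filter" and L :: "('f, 'r) lang" and M :: "('f, 'r, 'a) struct"
    and rep :: "((nat \<Rightarrow> 'i) \<Rightarrow> 'a) \<Rightarrow> 'u"
  assumes ultra: "ultra D" and struct: "is_structure L M"
    and rep: "\<And>f g. f \<in> fin_dep_fun (univ M) \<Longrightarrow> g \<in> fin_dep_fun (univ M) \<Longrightarrow>
      rep f = rep g \<longleftrightarrow> lim_ev D (\<lambda>x. f x = g x)"
begin

abbreviation "F \<equiv> fin_dep_fun (univ M) :: ((nat \<Rightarrow> 'i) \<Rightarrow> 'a) set"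

definition sel :: "'u \<Rightarrow> (nat \<Rightarrow> 'i) \<Rightarrow> 'a" where
  "sel u = (SOME f. f \<in> F \<and> rep f = u)"

text \<open>Elements are names in \<open>'u\<close>, so symbols are interpreted through the
  representatives chosen by \<open>sel\<close>. \<open>fint_power\<close> and
  \<open>rint_power\<close> show that other representatives give the same result.\<close>

definition power :: "('f, 'r, 'u) struct" where
  "power = \<lparr> univ = rep ` F,
     fint = (\<lambda>f us. rep (\<lambda>x. fint M f (map (\<lambda>u. sel u x) us))),
     rint = (\<lambda>r us. lim_ev D (\<lambda>x. rint M r (map (\<lambda>u. sel u x) us))) \<rparr>"

lemma univ_power: "univ power = rep ` F" by (simp add: power_def)

lemma sel: "u \<in> rep ` F \<Longrightarrow> sel u \<in> F \<and> rep (sel u) = u"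
  unfolding sel_def by (rule someI_ex[of "\<lambda>f. f \<in> F \<and> rep f = u"]) auto

lemma const_in_F: "a \<in> univ M \<Longrightarrow> (\<lambda>_. a) \<in> F"
  by (auto simp: fin_dep_fun_def fin_dep_def depends_below_def)

text \<open>Independence of representatives rests on this: a symbol takes finitely many arguments,
  and finitely many agreements almost everywhere combine into one.\<close>

lemma sel_agree:
  assumes "set fs \<subseteq> F"
  shows "lim_ev D (\<lambda>x. map (\<lambda>u. sel u x) (map rep fs) = map (\<lambda>f. f x) fs)"
proof -
  have "lim_ev D (\<lambda>x. sel (rep f) x = f x)" if "f \<in> F" for f
    using that sel[of "rep f"] rep[of "sel (rep f)" f] by auto
  then have "lim_ev D (\<lambda>x. \<forall>f\<in>set fs. sel (rep f) x = f x)"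
    using assms by (intro lim_ev_ball_finite ultra) auto
  then show ?thesis by (simp add: comp_def)
qed

lemma fin_dep_sel: "u \<in> rep ` F \<Longrightarrow> fin_dep (sel u)"
  using sel by (auto simp: fin_dep_fun_def)

lemma fin_dep_map_sel:
  assumes "set fs \<subseteq> F"
  shows "fin_dep (\<lambda>x. map (\<lambda>u. sel u x) (map rep fs))"
proof -
  have "fin_dep (\<lambda>x. map (\<lambda>f. f x) (map sel (map rep fs)))"
    using assms by (intro fin_dep_map) (auto intro!: fin_dep_sel)
  then show ?thesis by (simp add: comp_def)
qed

lemma fin_dep_map_F: "set fs \<subseteq> F \<Longrightarrow> fin_dep (\<lambda>x. map (\<lambda>f. f x) fs)"
  by (intro fin_dep_map) (auto simp: fin_dep_fun_def)

lemma fint_in_F: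
  assumes "f \<in> fsyms L" "set fs \<subseteq> F" "length fs = farity L f"
  shows "(\<lambda>x. fint M f (map (\<lambda>g. g x) fs)) \<in> F"
proof -
  have "map (\<lambda>g. g x) fs \<in> tuples (univ M) (farity L f)" for x
    using assms by (force simp: tuples_def fin_dep_fun_def)
  then have "fint M f (map (\<lambda>g. g x) fs) \<in> univ M" for x
    using assms struct by (auto simp: is_structure_def)
  then show ?thesis using fin_dep_comp[OF fin_dep_map_F[OF assms(2)], of "fint M f"]
    by (auto simp: fin_dep_fun_def)
qed

lemma fint_power:
  assumes "f \<in> fsyms L" "set fs \<subseteq> F" "length fs = farity L f"
  shows "fint power f (map rep fs) = rep (\<lambda>x. fint M f (map (\<lambda>g. g x) fs))"
proof -
  have "set (map sel (map rep fs)) \<subseteq> F" "length (map sel (map rep fs)) = farity L f"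
    using assms(2,3) sel by auto
  from fint_in_F[OF assms(1) this] have 1: "(\<lambda>x. fint M f (map (\<lambda>u. sel u x) (map rep fs))) \<in> F"
    by (simp add: comp_def)
  have "lim_ev D (\<lambda>x. fint M f (map (\<lambda>u. sel u x) (map rep fs)) = fint M f (map (\<lambda>g. g x) fs))"
    by (rule lim_ev_mono[OF ultra sel_agree[OF assms(2)]
        fin_dep_comp2[OF fin_dep_map_sel[OF assms(2)] fin_dep_map_F[OF assms(2)],
          where h = "\<lambda>xs ys. fint M f xs = fint M f ys"]]) (simp only:)
  then show ?thesis using rep[OF 1 fint_in_F[OF assms]] by (simp add: power_def)
qed

lemma rint_power:
  assumes "set fs \<subseteq> F"
  shows "rint power r (map rep fs) \<longleftrightarrow> lim_ev D (\<lambda>x. rint M r (map (\<lambda>g. g x) fs))"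
proof -
  let ?P = "\<lambda>x. map (\<lambda>u. sel u x) (map rep fs)" and ?Q = "\<lambda>x. map (\<lambda>g. g x) fs"
  have P: "fin_dep (\<lambda>x. rint M r (?P x))" and Q: "fin_dep (\<lambda>x. rint M r (?Q x))"
    using fin_dep_comp[OF fin_dep_map_sel[OF assms], of "rint M r"]
      fin_dep_comp[OF fin_dep_map_F[OF assms], of "rint M r"] .
  have "lim_ev D (\<lambda>x. rint M r (?P x)) \<longleftrightarrow> lim_ev D (\<lambda>x. rint M r (?Q x))"
  proof
    assume "lim_ev D (\<lambda>x. rint M r (?P x))"
    from lim_ev_conj[OF ultra this sel_agree[OF assms]] show "lim_ev D (\<lambda>x. rint M r (?Q x))"
      by (rule lim_ev_mono[OF ultra _ Q]) (elim conjE, simp only:)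
  next
    assume "lim_ev D (\<lambda>x. rint M r (?Q x))"
    from lim_ev_conj[OF ultra this sel_agree[OF assms]] show "lim_ev D (\<lambda>x. rint M r (?P x))"
      by (rule lim_ev_mono[OF ultra _ P]) (elim conjE, simp only:)
  qed
  then show ?thesis by (simp add: power_def)
qed

lemma ex_map_rep:
  assumes "set us \<subseteq> rep ` F"
  shows "\<exists>fs. set fs \<subseteq> F \<and> us = map rep fs"
proof -
  have "us \<in> map rep ` lists F" unfolding lists_image[symmetric] using assms by auto
  then show ?thesis by auto
qed

lemma is_structure_power: "is_structure L power"
  unfolding is_structure_def
proof (intro conjI ballI)
  show "univ power \<noteq> {}" using struct const_in_F by (auto simp: univ_power is_structure_def)
  fix f us assume f: "f \<in> fsyms L" and us: "us \<in> tuples (univ power) (farity L f)"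
  then obtain fs where "set fs \<subseteq> F" "us = map rep fs"
    using ex_map_rep[of us] by (auto simp: tuples_def univ_power)
  then show "fint power f us \<in> univ power"
    using f us fint_power[of f fs] fint_in_F[of f fs] by (auto simp: univ_power tuples_def)
qed

lemma trm_val_power:
  assumes "range fs \<subseteq> F" "wf_trm L t"
  shows "(\<lambda>x. trm_val M (\<lambda>i. fs i x) t) \<in> F \<and>
    trm_val power (\<lambda>i. rep (fs i)) t = rep (\<lambda>x. trm_val M (\<lambda>i. fs i x) t)"
  using assms(2)
proof (induction t)
  case (Var v)
  then show ?case using assms(1) by (auto simp: image_subset_iff)
next
  case (App f ts)
  let ?fs = "map (\<lambda>t x. trm_val M (\<lambda>i. fs i x) t) ts"
  have fs: "f \<in> fsyms L" "set ?fs \<subseteq> F" "length ?fs = farity L f"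
    using App by (auto simp: list_all_iff)
  have "map (trm_val power (\<lambda>i. rep (fs i))) ts = map rep ?fs"
    using App by (auto simp: list_all_iff)
  then have "trm_val power (\<lambda>i. rep (fs i)) (App f ts) = fint power f (map rep ?fs)"
    by (simp only: trm_val.simps)
  then show ?case using fint_power[OF fs] fint_in_F[OF fs] by (simp add: comp_def)
qed

text \<open>Finitely many free variables have a common bound on their coordinates. In the first form
  the whole solution set for \<open>v\<close> is the value of the function, which is what the choice
  of witnesses needs.\<close>

lemma fin_dep_sat:
  assumes "range fs \<subseteq> F"
  shows "fin_dep (\<lambda>x a. sat M ((\<lambda>i. fs i x)(v := a)) \<phi>)" "fin_dep (\<lambda>x. sat M (\<lambda>i. fs i x) \<phi>)"
proof -
  have "\<exists>n. \<forall>i\<in>fv \<phi>. depends_below n (fs i)"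
    using assms by (intro fin_dep_common finite_fv) (auto simp: fin_dep_fun_def)
  then obtain n where "\<forall>i\<in>fv \<phi>. depends_below n (fs i)" by blast
  then have n: "fs i x = fs i y" if "i \<in> fv \<phi>" "\<forall>i<n. x i = y i" for i x y
    using that unfolding depends_below_def by blast
  have "depends_below n (\<lambda>x a. sat M ((\<lambda>i. fs i x)(v := a)) \<phi>)"
    unfolding depends_below_def using n by (intro allI impI ext sat_cong) auto
  then show "fin_dep (\<lambda>x a. sat M ((\<lambda>i. fs i x)(v := a)) \<phi>)" by (auto simp: fin_dep_def)
  have "depends_below n (\<lambda>x. sat M (\<lambda>i. fs i x) \<phi>)"
    unfolding depends_below_def using n by (intro allI impI sat_cong) auto
  then show "fin_dep (\<lambda>x. sat M (\<lambda>i. fs i x) \<phi>)" by (auto simp: fin_dep_def)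
qed

theorem Los:
  assumes "\<phi> \<in> formulas L" "range fs \<subseteq> F"
  shows "sat power (\<lambda>i. rep (fs i)) \<phi> \<longleftrightarrow> lim_ev D (\<lambda>x. sat M (\<lambda>i. fs i x) \<phi>)"
proof -
  have "wf_fm L \<phi>" using assms by (simp add: formulas_def)
  then show ?thesis using assms(2)
  proof (induction \<phi> arbitrary: fs)
    case (Eq s t)
    then show ?case using trm_val_power[of fs s] trm_val_power[of fs t] by (simp add: rep)
  next
    case (Rel r ts)
    let ?fs = "map (\<lambda>t x. trm_val M (\<lambda>i. fs i x) t) ts"
    have fs: "set ?fs \<subseteq> F"
      using Rel trm_val_power[of fs] by (auto simp: list_all_iff)
    have "map (trm_val power (\<lambda>i. rep (fs i))) ts = map rep ?fs"
      using Rel trm_val_power[of fs] by (auto simp: list_all_iff)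
    then have "sat power (\<lambda>i. rep (fs i)) (Rel r ts) \<longleftrightarrow> rint power r (map rep ?fs)"
      by (simp only: sat.simps)
    then show ?case using rint_power[OF fs, of r] by (simp add: comp_def)
  next
    case (Neg \<phi>)
    then show ?case using lim_ev_not[OF ultra fin_dep_sat(2)] by simp
  next
    case (And \<phi> \<psi>)
    then show ?case using lim_ev_conj_iff[OF ultra fin_dep_sat(2) fin_dep_sat(2)] by simp
  next
    case (Exists v \<phi>)
    let ?Q = "\<lambda>x a. a \<in> univ M \<and> sat M ((\<lambda>i. fs i x)(v := a)) \<phi>"
    have Q: "fin_dep (\<lambda>x. h (?Q x))" for h :: "('a \<Rightarrow> bool) \<Rightarrow> 'b"
      using fin_dep_comp[OF fin_dep_sat(1)[OF Exists.prems(2)], of "\<lambda>P. h (\<lambda>a. a \<in> univ M \<and> P a)"] .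
    have IH: "sat power ((\<lambda>i. rep (fs i))(v := rep g)) \<phi> \<longleftrightarrow>
        lim_ev D (\<lambda>x. sat M ((\<lambda>i. fs i x)(v := g x)) \<phi>)" if g: "g \<in> F" for g
    proof -
      have "(\<lambda>i. rep ((fs(v := g)) i)) = (\<lambda>i. rep (fs i))(v := rep g)"
        "(\<lambda>i. (fs(v := g)) i x) = (\<lambda>i. fs i x)(v := g x)" for x
        by (auto simp: fun_eq_iff)
      moreover have "range (fs(v := g)) \<subseteq> F" using Exists.prems g by auto
      ultimately show ?thesis using Exists.IH[of "fs(v := g)"] Exists.prems by (simp only: wf_fm.simps)
    qed
    show ?case
    proof
      assume "sat power (\<lambda>i. rep (fs i)) (Exists v \<phi>)"
      then obtain g where g: "g \<in> F" "sat power ((\<lambda>i. rep (fs i))(v := rep g)) \<phi>"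
        by (auto simp: univ_power)
      then have "lim_ev D (\<lambda>x. sat M ((\<lambda>i. fs i x)(v := g x)) \<phi>)" using IH by simp
      then have "lim_ev D (\<lambda>x. Ex (?Q x))"
        by (rule lim_ev_mono[OF ultra _ Q]) (use g in \<open>auto simp: fin_dep_fun_def\<close>)
      then show "lim_ev D (\<lambda>x. sat M (\<lambda>i. fs i x) (Exists v \<phi>))" by (simp add: Bex_def)
    next
      assume "lim_ev D (\<lambda>x. sat M (\<lambda>i. fs i x) (Exists v \<phi>))"
      then have *: "lim_ev D (\<lambda>x. Ex (?Q x))" by (simp add: Bex_def)
      obtain d where d: "d \<in> univ M" using struct by (auto simp: is_structure_def)
      \<comment> \<open>The witness is chosen from the solution set alone. Points with the same set
        get the same witness, so \<open>g\<close> inherits the finite dependence; \<open>d\<close>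
        keeps its values in \<open>M\<close> where there is no solution.\<close>
      define g where "g x = (if Ex (?Q x) then SOME a. ?Q x a else d)" for x
      have g_Q: "?Q x (g x)" if "Ex (?Q x)" for x
        unfolding g_def using that someI_ex[OF that] by simp
      have "g x \<in> univ M" for x
        using d g_Q[of x] by (cases "Ex (?Q x)") (auto simp: g_def)
      moreover have "fin_dep g"
        unfolding g_def using Q[of "\<lambda>P. if Ex P then SOME a. P a else d"] .
      ultimately have g: "g \<in> F" by (auto simp: fin_dep_fun_def)
      have "fin_dep (\<lambda>x. sat M (\<lambda>i. (fs(v := g)) i x) \<phi>)"
        by (rule fin_dep_sat(2)) (use Exists.prems g in auto)
      moreover have "(\<lambda>i. (fs(v := g)) i x) = (\<lambda>i. fs i x)(v := g x)" for x by auto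
      ultimately have "fin_dep (\<lambda>x. sat M ((\<lambda>i. fs i x)(v := g x)) \<phi>)" by (simp only:)
      from lim_ev_mono[OF ultra * this] g_Q have "lim_ev D (\<lambda>x. sat M ((\<lambda>i. fs i x)(v := g x)) \<phi>)"
        by blast
      then have "sat power ((\<lambda>i. rep (fs i))(v := rep g)) \<phi>" using IH[OF g] by simp
      then show "sat power (\<lambda>i. rep (fs i)) (Exists v \<phi>)" using g by (auto simp: univ_power)
    qed
  qed
qed

text \<open>Indexing a list beyond its length is unspecified, so the list is first completed to an
  assignment by a constant function; the bound on the free variables makes the completion
  invisible.\<close>

lemma Los_list:
  assumes "\<phi> \<in> formulas L" "set fs \<subseteq> F" "fv \<phi> \<subseteq> {..<length fs}"
  shows "sat power ((!) (map rep fs)) \<phi> \<longleftrightarrow> lim_ev D (\<lambda>x. sat M ((!) (map (\<lambda>f. f x) fs)) \<phi>)"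
proof -
  obtain d where d: "d \<in> univ M" using struct by (auto simp: is_structure_def)
  define gs where "gs i = (if i < length fs then fs ! i else (\<lambda>_. d))" for i
  have "range gs \<subseteq> F" using assms(2) const_in_F[OF d] by (auto simp: gs_def subset_iff)
  then have "sat power (\<lambda>i. rep (gs i)) \<phi> \<longleftrightarrow> lim_ev D (\<lambda>x. sat M (\<lambda>i. gs i x) \<phi>)"
    using assms(1) by (intro Los)
  moreover have "sat power ((!) (map rep fs)) \<phi> \<longleftrightarrow> sat power (\<lambda>i. rep (gs i)) \<phi>"
    using assms(3) by (intro sat_cong) (auto simp: gs_def)
  moreover have "sat M ((!) (map (\<lambda>f. f x) fs)) \<phi> \<longleftrightarrow> sat M (\<lambda>i. gs i x) \<phi>" for x
    using assms(3) by (intro sat_cong) (auto simp: gs_def)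
  ultimately show ?thesis by simp
qed

lemma diagonal_elem_embedding: "elem_embedding L M power (\<lambda>a. rep (\<lambda>_. a))"
  unfolding elem_embedding_def
proof (intro conjI ballI allI impI)
  show "(\<lambda>a. rep (\<lambda>_. a)) ` univ M \<subseteq> univ power" using const_in_F by (auto simp: univ_power)
  fix \<phi> and e :: "nat \<Rightarrow> 'a" assume "\<phi> \<in> formulas L" "range e \<subseteq> univ M"
  then have "sat power (\<lambda>i. rep (\<lambda>_. e i)) \<phi> \<longleftrightarrow> lim_ev D (\<lambda>x. sat M e \<phi>)"
    using Los[of \<phi> "\<lambda>i _. e i"] const_in_F by auto
  moreover have "lim_ev D (\<lambda>x. sat M e \<phi>) \<longleftrightarrow> sat M e \<phi>"
    using lim_ev_iff[OF ultra, of 0 "\<lambda>x. sat M e \<phi>"] by (simp add: depends_below_def)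
  ultimately show "sat M e \<phi> \<longleftrightarrow> sat power ((\<lambda>a. rep (\<lambda>_. a)) \<circ> e) \<phi>" by (simp add: comp_def)
qed

end

text \<open>Parameters are recorded by their positions in a list of them, as natural numbers. The
  index set therefore mentions no elements: one ultrafilter serves all finite parameter sets, all
  stages and both structures, and its relevant part is no larger than
  \<open>formulas L\<close>.\<close>

locale saturated_limit_ultrapower = limit_ultrapower D L M rep
  for D :: "(('f, 'r) fm \<times> nat list) set filter" and L :: "('f, 'r) lang"
    and M :: "('f, 'r, 'a) struct" and rep :: "((nat \<Rightarrow> (('f, 'r) fm \<times> nat list) set) \<Rightarrow> 'a) \<Rightarrow> 'u" +
  assumes regular: "D \<le> finite_subsets_at_top (formulas L \<times> UNIV)"
begin

text \<open>A type \<open>p\<close> over a finite set of parameters \<open>us\<close> living at stage \<open>n\<close> is realized at stage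
  \<open>n + 1\<close> by the function of the new coordinate \<open>s\<close> that picks a realization of the finite part of
  \<open>p\<close> indexed by \<open>s\<close>.\<close>

lemma aleph0_saturated_power: "aleph0_saturated L power"
  unfolding aleph0_saturated_def
proof (intro allI impI)
  fix A k and p :: "(('f, 'r) fm \<times> 'u list) set"
  assume "finite A \<and> A \<subseteq> univ power \<and> is_type L power A k p"
  then have A: "finite A" "A \<subseteq> rep ` F" and p: "p \<subseteq> param_formulas L A k"
    and fin_sat: "\<And>q. q \<subseteq> p \<Longrightarrow> finite q \<Longrightarrow> \<exists>xs\<in>tuples (univ power) k. realizes power xs q"
    by (auto simp: univ_power is_type_def)
  obtain us where us: "set us = A" using finite_list[OF A(1)] by blast
  obtain fs where fs: "set fs \<subseteq> F" "us = map rep fs" using ex_map_rep[of us] us A(2) by auto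
  have "\<exists>n. \<forall>f\<in>set fs. depends_below n f"
    using fs(1) by (intro fin_dep_common) (auto simp: fin_dep_fun_def)
  then obtain n where n: "\<forall>f\<in>set fs. depends_below n f" by blast
  \<comment> \<open>The type \<open>p\<close> with positions in \<open>us\<close> in place of the
    parameters.\<close>
  define pt where "pt = {(\<phi>, idx). set idx \<subseteq> {..<length fs} \<and> (\<phi>, map ((!) us) idx) \<in> p}"
  define val where "val x a idx = (!) (a @ map (\<lambda>j. (fs ! j) x) idx)" for x a idx
  define good where "good s x a \<longleftrightarrow> a \<in> tuples (univ M) k \<and> 
      (\<forall>z\<in>s \<inter> pt. sat M (val x a (snd z)) (fst z))"
    for s x a
  obtain d where d: "d \<in> univ M" using struct by (auto simp: is_structure_def)
  \<comment> \<open>A realization at the point \<open>x\<close> of the part of the type listed in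
    \<open>s\<close>, if there is one. The default tuple keeps the components in
    \<open>univ M\<close> at every point, as membership in \<open>F\<close> requires.\<close>
  define G where "G s x = (if Ex (good s x) then SOME a. good s x a else replicate k d)" for s x
  have G_good: "good s x (G s x)" if "Ex (good s x)" for s x
    unfolding G_def using that someI_ex[OF that] by simp
  have G_tup: "G s x \<in> tuples (univ M) k" for s x
  proof (cases "Ex (good s x)")
    case True
    then show ?thesis using G_good[OF True] by (simp add: good_def)
  next
    case False
    then show ?thesis using d by (auto simp: G_def tuples_def simp del: not_ex)
  qed
  have val_cong: "val x a idx = val y a idx"
    if "\<forall>i<n. x i = y i" "set idx \<subseteq> {..<length fs}" for x y a idx
  proof -
    have "(fs ! j) x = (fs ! j) y" if "j \<in> set idx" for j
      using n \<open>\<forall>i<n. x i = y i\<close> \<open>set idx \<subseteq> {..<length fs}\<close> that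
      unfolding depends_below_def by (meson lessThan_iff nth_mem subsetD)
    then show ?thesis unfolding val_def by (metis (mono_tags, lifting) map_eq_conv)
  qed
  have good_cong: "good s x = good s y" if "\<forall>i<n. x i = y i" for s x y
  proof
    fix a
    have "val x a (snd z) = val y a (snd z)" if "z \<in> s \<inter> pt" for z
      using that by (intro val_cong \<open>\<forall>i<n. x i = y i\<close>) (auto simp: pt_def)
    then show "good s x a = good s y a" unfolding good_def by auto
  qed
  have G_cong: "G (x n) x = G (y n) y" if "\<forall>i<Suc n. x i = y i" for x y
  proof -
    have "good (x n) x = good (y n) y" using that good_cong[of x y "y n"] by simp
    then show ?thesis by (simp only: G_def)
  qed
  \<comment> \<open>The coordinate \<open>x n\<close> names the finite part to realize, while the
    coordinates below \<open>n\<close> determine the parameters; hence dependence below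
    \<open>Suc n\<close>.\<close>
  define g where "g j x = G (x n) x ! j" for j x
  have g_F: "g j \<in> F" if "j < k" for j
  proof -
    have "depends_below (Suc n) (g j)" unfolding depends_below_def g_def using G_cong by metis
    moreover have "g j x \<in> univ M" for x
      using G_tup[of "x n" x] that by (auto simp: g_def tuples_def subset_iff)
    ultimately show ?thesis by (auto simp: fin_dep_fun_def fin_dep_def)
  qed
  have map_g: "map (\<lambda>f. f x) (map g [0..<k]) = G (x n) x" for x
    using G_tup[of "x n" x] by (auto simp: g_def tuples_def intro!: nth_equalityI)
  have transfer: "sat power ((!) (map rep hs @ map ((!) us) idx)) \<phi> \<longleftrightarrow>
      lim_ev D (\<lambda>x. sat M (val x (map (\<lambda>h. h x) hs) idx) \<phi>)"
    if hs: "set hs \<subseteq> F" "length hs = k" and pt: "(\<phi>, idx) \<in> pt" for hs \<phi> idx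
  proof -
    have idx: "set idx \<subseteq> {..<length fs}" and "(\<phi>, map ((!) us) idx) \<in> p" using pt by (auto simp: pt_def)
    then have "(\<phi>, map ((!) us) idx) \<in> param_formulas L A k" using p by blast
    then have \<phi>: "\<phi> \<in> formulas L" "fv \<phi> \<subseteq> {..<k + length idx}"
      by (auto simp: param_formulas_def)
    let ?es = "hs @ map ((!) fs) idx"
    have "set ?es \<subseteq> F" using hs idx fs(1) by (auto simp: subset_iff)
    moreover have "map rep ?es = map rep hs @ map ((!) us) idx"
      using idx fs(2) by (auto simp: subset_iff)
    moreover have "(!) (map (\<lambda>f. f x) ?es) = val x (map (\<lambda>h. h x) hs) idx" for x
      by (simp add: val_def comp_def)
    ultimately show ?thesis using Los_list[OF \<phi>(1), of ?es] \<phi>(2) hs(2) by (simp only: length_append length_map)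
  qed
  let ?xs = "map rep (map g [0..<k])"
  have "sat power ((!) (?xs @ ps)) \<phi>" if \<phi>: "(\<phi>, ps) \<in> p" for \<phi> ps
  proof -
    have "set ps \<subseteq> (!) us ` {..<length fs}"
    proof -
      have "set ps \<subseteq> set us" using \<phi> p us by (auto simp: param_formulas_def)
      also have "set us = (!) us ` {..<length us}" by (auto simp: set_conv_nth)
      finally show ?thesis using fs(2) by simp
    qed
    then have "ps \<in> map ((!) us) ` lists {..<length fs}" unfolding lists_image[symmetric] by auto
    then obtain idx where idx: "set idx \<subseteq> {..<length fs}" "ps = map ((!) us) idx" by auto
    then have pt: "(\<phi>, idx) \<in> pt" using \<phi> by (auto simp: pt_def)
    let ?P = "\<lambda>x. sat M (val x (G (x n) x) idx) \<phi>"
    have P_dep: "depends_below (Suc n) ?P"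
      unfolding depends_below_def
    proof (intro allI impI)
      fix x y :: "nat \<Rightarrow> (('f, 'r) fm \<times> nat list) set" assume xy: "\<forall>i<Suc n. x i = y i"
      then have "val x a idx = val y a idx" for a using idx(1) by (intro val_cong) auto
      then show "?P x = ?P y" using G_cong[OF xy] by simp
    qed
    have "(\<phi>, idx) \<in> formulas L \<times> UNIV" using \<phi> p by (auto simp: param_formulas_def)
    then have "eventually (\<lambda>s. finite s \<and> (\<phi>, idx) \<in> s) (finite_subsets_at_top (formulas L \<times> UNIV))"
      unfolding eventually_finite_subsets_at_top by (intro exI[of _ "{(\<phi>, idx)}"]) auto
    then have "eventually (\<lambda>s. finite s \<and> (\<phi>, idx) \<in> s) D" using regular filter_leD by blast
    then have "eventually (\<lambda>s. iter_ev D n ?P ((\<lambda>_. {})(n := s))) D"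
    proof eventually_elim
      case (elim s)
      let ?q = "(\<lambda>(\<phi>, idx). (\<phi>, map ((!) us) idx)) ` (s \<inter> pt)"
      have "?q \<subseteq> p" "finite ?q" using elim by (auto simp: pt_def)
      then obtain xs where xs: "xs \<in> tuples (univ power) k" "realizes power xs ?q"
        using fin_sat by blast
      then obtain hs where hs: "set hs \<subseteq> F" "xs = map rep hs"
        using ex_map_rep[of xs] by (auto simp: tuples_def univ_power)
      have len: "length hs = k" using xs(1) hs(2) by (simp add: tuples_def)
      have "lim_ev D (\<lambda>x. sat M (val x (map (\<lambda>h. h x) hs) (snd z)) (fst z))" if "z \<in> s \<inter> pt" for z
      proof -
        have "sat power ((!) (xs @ map ((!) us) (snd z))) (fst z)"
          using xs(2) that by (auto simp: realizes_def split_beta)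
        then show ?thesis using transfer[OF hs(1) len, of "fst z" "snd z"] that hs(2) by simp
      qed
      then have "lim_ev D (\<lambda>x. \<forall>z\<in>s \<inter> pt. sat M (val x (map (\<lambda>h. h x) hs) (snd z)) (fst z))"
        using elim by (intro lim_ev_ball_finite ultra) auto
      \<comment> \<open>The realization \<open>hs\<close> may depend on coordinates far beyond
        \<open>n\<close>. What descends to stage \<open>n\<close> is the existence of a realization,
        because \<open>good s x\<close> reads only the parameters.\<close>
      moreover have good_dep: "depends_below n (\<lambda>x. Ex (good s x))"
        using good_cong by (auto simp only: depends_below_def)
      moreover have "Ex (good s x)"
        if "\<forall>z\<in>s \<inter> pt. sat M (val x (map (\<lambda>h. h x) hs) (snd z)) (fst z)" for x
      proof -
        have "map (\<lambda>h. h x) hs \<in> tuples (univ M) k"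
          using hs(1) len by (auto simp: tuples_def fin_dep_fun_def)
        then have "good s x (map (\<lambda>h. h x) hs)" using that unfolding good_def by auto
        then show ?thesis by blast
      qed
      ultimately have "lim_ev D (\<lambda>x. Ex (good s x))"
        using lim_ev_mono[OF ultra] unfolding fin_dep_def by blast
      then have "iter_ev D n (\<lambda>x. Ex (good s x)) ((\<lambda>_. {})(n := s))"
        using lim_ev_iff[OF ultra good_dep] by blast
      then show ?case
      proof (rule iter_ev_mono)
        \<comment> \<open>The inner quantifiers leave the coordinate \<open>n\<close> untouched, so
          \<open>G (y n) y\<close> is the realization for this very \<open>s\<close>.\<close>
        fix y assume y: "\<And>i. n \<le> i \<Longrightarrow> y i = ((\<lambda>_. {})(n := s)) i" and "Ex (good s y)"
        then have "good s y (G s y)" by (intro G_good)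
        moreover have "y n = s" using y[of n] by simp
        moreover have "(\<phi>, idx) \<in> s \<inter> pt" using elim pt by simp
        ultimately show "?P y" unfolding good_def by (metis fst_conv snd_conv)
      qed
    qed
    then have "lim_ev D ?P" using lim_ev_iff[OF ultra P_dep] by simp
    moreover have "set (map g [0..<k]) \<subseteq> F" "length (map g [0..<k]) = k" using g_F by auto
    ultimately show ?thesis using transfer[OF _ _ pt, of "map g [0..<k]"] idx(2) unfolding map_g by simp
  qed
  moreover have "?xs \<in> tuples (univ power) k" using g_F by (auto simp: tuples_def univ_power)
  ultimately show "\<exists>xs\<in>tuples (univ power) k. realizes power xs p"
    unfolding realizes_def by blast
qed

end

section \<open>Embeddings induced on limit ultrapowers, and the number of their elements\<close>

lemma limit_ultrapower_embedding:
  fixes repA :: "((nat \<Rightarrow> 'i) \<Rightarrow> 'a) \<Rightarrow> 'u" and repB :: "((nat \<Rightarrow> 'i) \<Rightarrow> 'a) \<Rightarrow> 'u"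
  assumes A: "limit_ultrapower D L A repA" and B: "limit_ultrapower D L B repB"
    and AB: "substructure L A B"
  shows "\<exists>h. embedding L (limit_ultrapower.power D A repA) (limit_ultrapower.power D B repB) h \<and>
    (\<forall>f\<in>fin_dep_fun (univ A). h (repA f) = repB f)"
proof -
  interpret A: limit_ultrapower D L A repA by (rule A)
  interpret B: limit_ultrapower D L B repB by (rule B)
  have sub: "univ A \<subseteq> univ B"
    and fint: "\<And>f xs. f \<in> fsyms L \<Longrightarrow> xs \<in> tuples (univ A) (farity L f) \<Longrightarrow> fint A f xs = fint B f xs"
    and rint: "\<And>r xs. r \<in> rsyms L \<Longrightarrow> xs \<in> tuples (univ A) (rarity L r) \<Longrightarrow> rint A r xs = rint B r xs"
    using AB by (auto simp: substructure_def embedding_def)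
  have FAB: "A.F \<subseteq> B.F" using sub by (auto simp: fin_dep_fun_def)
  \<comment> \<open>The same \<open>D\<close> is used on both sides, so equality almost everywhere
    means the same for functions into \<open>univ A\<close> and into \<open>univ B\<close>. Hence
    inclusion of functions is well defined and injective on classes.\<close>
  define h where "h u = repB (A.sel u)" for u
  have h: "h (repA f) = repB f" if f: "f \<in> A.F" for f
  proof -
    have "A.sel (repA f) \<in> A.F" "repA (A.sel (repA f)) = repA f" using A.sel f by auto
    then have "lim_ev D (\<lambda>x. A.sel (repA f) x = f x)" using A.rep f by blast
    then show ?thesis using B.rep[of "A.sel (repA f)" f] f FAB \<open>A.sel (repA f) \<in> A.F\<close>
      unfolding h_def by blast
  qed
  have tup: "map (\<lambda>g. g x) fs \<in> tuples (univ A) (length fs)" if "set fs \<subseteq> A.F" for fs and x :: "nat \<Rightarrow> 'i"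
    using that by (force simp: tuples_def fin_dep_fun_def)
  have map_h: "map h (map repA fs) = map repB fs" if "set fs \<subseteq> A.F" for fs
    using that h by auto
  have "embedding L A.power B.power h"
    unfolding embedding_def
  proof (intro conjI ballI)
    show "h ` univ A.power \<subseteq> univ B.power" using h FAB by (auto simp: A.univ_power B.univ_power)
    show "inj_on h (univ A.power)"
    proof (rule inj_onI)
      fix u v assume "u \<in> univ A.power" "v \<in> univ A.power" "h u = h v"
      then obtain f g where "f \<in> A.F" "g \<in> A.F" "u = repA f" "v = repA g" "repB f = repB g"
        using h by (auto simp: A.univ_power)
      then show "u = v" using A.rep[of f g] B.rep[of f g] FAB by blast
    qed
    fix f us assume f: "f \<in> fsyms L" and us: "us \<in> tuples (univ A.power) (farity L f)"
    then obtain fs where fs: "set fs \<subseteq> A.F" "us = map repA fs" "length fs = farity L f"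
      using A.ex_map_rep[of us] by (auto simp: tuples_def A.univ_power)
    have "h (fint A.power f us) = repB (\<lambda>x. fint A f (map (\<lambda>g. g x) fs))"
      using A.fint_power[OF f fs(1,3)] h[OF A.fint_in_F[OF f fs(1,3)]] fs(2) by simp
    also have "(\<lambda>x. fint A f (map (\<lambda>g. g x) fs)) = (\<lambda>x. fint B f (map (\<lambda>g. g x) fs))"
      using fint[OF f] tup[OF fs(1)] fs(3) by auto
    also have "repB \<dots> = fint B.power f (map repB fs)"
      using B.fint_power[OF f _ fs(3)] fs(1) FAB by auto
    finally show "h (fint A.power f us) = fint B.power f (map h us)"
      unfolding fs(2) map_h[OF fs(1)] .
  next
    fix r us assume r: "r \<in> rsyms L" and us: "us \<in> tuples (univ A.power) (rarity L r)"
    then obtain fs where fs: "set fs \<subseteq> A.F" "us = map repA fs" "length fs = rarity L r"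
      using A.ex_map_rep[of us] by (auto simp: tuples_def A.univ_power)
    have "rint A r (map (\<lambda>g. g x) fs) = rint B r (map (\<lambda>g. g x) fs)" for x :: "nat \<Rightarrow> 'i"
      using rint[OF r] tup[OF fs(1)] fs(3) by auto
    then have "rint A.power r us \<longleftrightarrow> rint B.power r (map repB fs)"
      using A.rint_power[OF fs(1), of r] B.rint_power[of fs r] fs(1,2) FAB by auto
    then show "rint A.power r us \<longleftrightarrow> rint B.power r (map h us)"
      unfolding fs(2) map_h[OF fs(1)] .
  qed
  then show ?thesis using h by blast
qed

text \<open>Up to equality almost everywhere only the values at sequences from \<open>I\<close>
  matter, and finite dependence reduces these to a set of pairs of a finite sequence and a value.
  There are at most as many such sets as subsets of \<open>K\<close>.\<close>

lemma ex_representation: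
  fixes D :: "'i filter" and A :: "'a set"
  assumes K: "infinite K" "Pow K \<lesssim> (UNIV :: 'u set)" "I \<lesssim> K" "A \<lesssim> K"
    and D: "ultra D" "eventually (\<lambda>s. s \<in> I) D"
  shows "\<exists>rep :: ((nat \<Rightarrow> 'i) \<Rightarrow> 'a) \<Rightarrow> 'u. \<forall>f\<in>fin_dep_fun A. \<forall>g\<in>fin_dep_fun A.
    rep f = rep g \<longleftrightarrow> lim_ev D (\<lambda>x. f x = g x)"
proof -
  let ?F = "fin_dep_fun A :: ((nat \<Rightarrow> 'i) \<Rightarrow> 'a) set"
  define E where "E f g \<longleftrightarrow> lim_ev D (\<lambda>x. f x = g x)" for f g :: "(nat \<Rightarrow> 'i) \<Rightarrow> 'a"
  have refl: "E f f" for f unfolding E_def by (rule lim_ev_True) simp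
  have sym: "E g f" if "E f g" for f g using that unfolding E_def by (simp add: eq_commute)
  have trans: "E f h" if "E f g" "E g h" "f \<in> ?F" "h \<in> ?F" for f g h
  proof -
    have "fin_dep (\<lambda>x. f x = h x)" using that(3,4) fin_dep_comp2[of f h "(=)"] by (auto simp: fin_dep_fun_def)
    then show ?thesis
      unfolding E_def
      by (rule lim_ev_mono[OF D(1) lim_ev_conj[OF D(1) that(1,2)[unfolded E_def]]]) auto
  qed
  \<comment> \<open>Equivalent functions satisfy the same predicate, so \<open>SOME\<close> returns
    a canonical representative of the class.\<close>
  define q where "q f = (SOME g. g \<in> ?F \<and> E f g)" for f
  have q: "q f \<in> ?F" "E f (q f)" if "f \<in> ?F" for f
    unfolding q_def using someI[of "\<lambda>g. g \<in> ?F \<and> E f g" f] refl[of f] that by auto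
  have q_eq: "q f = q g \<longleftrightarrow> E f g" if f: "f \<in> ?F" and g: "g \<in> ?F" for f g
  proof
    assume "q f = q g"
    then have "E (q f) g" using sym[OF q(2)[OF g]] by simp
    then show "E f g" by (rule trans[OF q(2)[OF f] _ f g])
  next
    assume "E f g"
    then have "(\<lambda>h. h \<in> ?F \<and> E f h) = (\<lambda>h. h \<in> ?F \<and> E g h)"
      using trans[OF sym[OF \<open>E f g\<close>] _ g] trans[OF \<open>E f g\<close> _ f] by auto
    then show "q f = q g" unfolding q_def by simp
  qed
  define code where "code f = {(map x [0..<n], f x) | x n. depends_below n f \<and> range x \<subseteq> I}"
    for f :: "(nat \<Rightarrow> 'i) \<Rightarrow> 'a"
  obtain s0 where "s0 \<in> I"
    using D eventually_happens[of "\<lambda>s. s \<in> I" D] by (auto simp: ultra_def)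
  have code_E: "E f g" if f: "f \<in> ?F" and g: "g \<in> ?F" and eq: "code f = code g" for f g
  proof -
    have "\<exists>n. \<forall>h\<in>{f, g}. depends_below n h"
      using f g by (intro fin_dep_common) (auto simp: fin_dep_fun_def)
    then obtain n where n: "depends_below n f" "depends_below n g" by auto
    have agree: "f x = g x" if x: "\<And>i. i < n \<Longrightarrow> x i \<in> I" for x
    proof -
      \<comment> \<open>Codes contain only sequences lying entirely in \<open>I\<close>;
        \<open>s0\<close> fills the coordinates on which neither function depends.\<close>
      define y where "y i = (if i < n then x i else s0)" for i
      have y: "range y \<subseteq> I" using x \<open>s0 \<in> I\<close> by (auto simp: y_def)
      then have "(map y [0..<n], f y) \<in> code f" using n unfolding code_def by blast
      then have "(map y [0..<n], f y) \<in> code g" using eq by simp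
      then obtain z m where z: "map y [0..<n] = map z [0..<m]" "f y = g z" by (auto simp: code_def)
      have "m = n" using arg_cong[OF z(1), of length] by simp
      then have "\<forall>i<n. y i = z i" using z(1) by (auto simp: map_eq_conv)
      moreover have "\<forall>i<n. x i = y i" by (simp add: y_def)
      ultimately show ?thesis using n z(2) unfolding depends_below_def by metis
    qed
    have "iter_ev D n (\<lambda>x. f x = g x) y" for y by (rule iter_ev_concentrated[OF D(2) agree])
    then show ?thesis
      using depends_below_comp2[OF n, of "(=)"] unfolding E_def lim_ev_def by blast
  qed
  have "code f \<subseteq> lists I \<times> A" if "f \<in> ?F" for f
    using that by (auto simp: code_def fin_dep_fun_def image_subset_iff)
  then have "inj_on code (q ` ?F) \<and> code ` (q ` ?F) \<subseteq> Pow (lists I \<times> A)"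
  proof (intro conjI inj_onI)
    fix u v assume "u \<in> q ` ?F" "v \<in> q ` ?F" "code u = code v"
    then obtain f g where fg: "f \<in> ?F" "g \<in> ?F" "u = q f" "v = q g" and "E u v"
      using code_E q(1) by auto
    have "E f (q g)" using trans[OF q(2)[OF fg(1)] _ fg(1) q(1)[OF fg(2)]] \<open>E u v\<close> fg by simp
    then have "E f g" using trans[OF _ sym[OF q(2)[OF fg(2)]] fg(1,2)] by blast
    then show "u = v" using fg q_eq by blast
  qed (use q(1) in blast)
  then have "q ` ?F \<lesssim> Pow (lists I \<times> A)" unfolding lepoll_def by blast
  also have "\<dots> \<lesssim> Pow K"
    using K by (intro Pow_lepoll_mono Times_lepoll_infinite lists_lepoll_infinite)
  also note K(2)
  finally obtain j :: "((nat \<Rightarrow> 'i) \<Rightarrow> 'a) \<Rightarrow> 'u" where j: "inj_on j (q ` ?F)"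
    unfolding lepoll_def by blast
  have "j (q f) = j (q g) \<longleftrightarrow> lim_ev D (\<lambda>x. f x = g x)" if "f \<in> ?F" "g \<in> ?F" for f g
    using j that q_eq[OF that] inj_on_eq_iff[OF j, of "q f" "q g"] by (simp add: E_def)
  then show ?thesis by (intro exI[of _ "\<lambda>f. j (q f)"]) blast
qed

text \<open>Taking the limit ultrapowers of both structures along the same ultrafilter makes them
  saturated while keeping the inclusion as an embedding.\<close>

lemma ex_saturated_extension_pair:
  fixes L :: "('f, 'r) lang" and A :: "('f, 'r, 'a) struct"
  assumes large: "Pow (formulas L) \<lesssim> (UNIV :: 'u set)"
    and A: "is_structure L A" "univ A \<lesssim> formulas L" and B: "is_structure L B" "univ B \<lesssim> formulas L"
    and AB: "substructure L A B"
  shows "\<exists>(A' :: ('f, 'r, 'u) struct) (B' :: ('f, 'r, 'u) struct) i j h.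
    is_structure L A' \<and> aleph0_saturated L A' \<and> elem_embedding L A A' i \<and>
    is_structure L B' \<and> aleph0_saturated L B' \<and> elem_embedding L B B' j \<and>
    embedding L A' B' h \<and> (\<forall>a\<in>univ A. h (i a) = j a)"
proof -
  let ?Y = "formulas L \<times> (UNIV :: nat list set)"
  obtain D where D: "ultra D" "D \<le> finite_subsets_at_top ?Y"
    using ex_ultra[of "finite_subsets_at_top ?Y"] by auto
  \<comment> \<open>The index type also contains infinite sets and formulas with symbols outside
    \<open>L\<close>. Only the finite subsets of \<open>?Y\<close> are counted, and \<open>D\<close>
    is concentrated on them.\<close>
  define I where "I = set ` lists ?Y"
  have "(UNIV :: nat set) \<lesssim> formulas L" using infinite_formulas infinite_le_lepoll by blast
  then have "lists (UNIV :: nat set) \<lesssim> formulas L" by (intro lists_lepoll_infinite infinite_formulas)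
  then have "(UNIV :: nat list set) \<lesssim> formulas L" by simp
  then have I_card: "I \<lesssim> formulas L"
    unfolding I_def
    by (intro lepoll_trans[OF image_lepoll] lists_lepoll_infinite Times_lepoll_infinite
        infinite_formulas lepoll_refl)
  have "eventually (\<lambda>s. s \<in> I) (finite_subsets_at_top ?Y)"
    unfolding eventually_finite_subsets_at_top I_def
    by (intro exI[of _ "{}"]) (metis (no_types, lifting) empty_subsetI finite.emptyI finite_list image_iff in_listsI subsetD)
  then have I_ev: "eventually (\<lambda>s. s \<in> I) D" using D(2) filter_leD by blast
  obtain repA :: "((nat \<Rightarrow> (('f, 'r) fm \<times> nat list) set) \<Rightarrow> 'a) \<Rightarrow> 'u" where repA:
    "\<forall>f\<in>fin_dep_fun (univ A). \<forall>g\<in>fin_dep_fun (univ A). repA f = repA g \<longleftrightarrow> lim_ev D (\<lambda>x. f x = g x)"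
    using ex_representation[OF infinite_formulas large I_card A(2) D(1) I_ev] by blast
  obtain repB :: "((nat \<Rightarrow> (('f, 'r) fm \<times> nat list) set) \<Rightarrow> 'a) \<Rightarrow> 'u" where repB:
    "\<forall>f\<in>fin_dep_fun (univ B). \<forall>g\<in>fin_dep_fun (univ B). repB f = repB g \<longleftrightarrow> lim_ev D (\<lambda>x. f x = g x)"
    using ex_representation[OF infinite_formulas large I_card B(2) D(1) I_ev] by blast
  interpret A: saturated_limit_ultrapower D L A repA
    using D A(1) repA by unfold_locales auto
  interpret B: saturated_limit_ultrapower D L B repB
    using D B(1) repB by unfold_locales auto
  obtain h where h: "embedding L A.power B.power h" "\<forall>f\<in>fin_dep_fun (univ A). h (repA f) = repB f"
    using limit_ultrapower_embedding[OF A.limit_ultrapower_axioms B.limit_ultrapower_axioms AB] by blast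
  show ?thesis
    by (intro exI[of _ A.power] exI[of _ B.power] exI[of _ "\<lambda>a. repA (\<lambda>_. a)"]
        exI[of _ "\<lambda>a. repB (\<lambda>_. a)"] exI[of _ h] conjI A.is_structure_power B.is_structure_power
        A.aleph0_saturated_power B.aleph0_saturated_power A.diagonal_elem_embedding
        B.diagonal_elem_embedding h(1) ballI)
      (use h(2) A.const_in_F in blast)
qed

section \<open>Model completeness of products\<close>

text \<open>Model completeness speaks of substructures, so \<open>A\<close> is replaced by its image
  in \<open>B\<close>, an isomorphic copy with the same theory.\<close>

lemma model_complete_embedding_elementary:
  fixes A :: "('f, 'r, 'u) struct" and B :: "('f, 'r, 'u) struct"
  assumes X: "is_structure L X" "model_complete TYPE('u) L X"
    and A: "is_structure L A" "elem_equiv L A X" and B: "is_structure L B" "elem_equiv L B X"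
    and h: "embedding L A B h"
  shows "elem_embedding L A B h"
proof -
  let ?C = "B\<lparr>univ := h ` univ A\<rparr>"
  have fint: "fint B f ys \<in> h ` univ A" if f: "f \<in> fsyms L" and ys: "ys \<in> tuples (h ` univ A) (farity L f)" for f ys
  proof -
    have "ys \<in> map h ` lists (univ A)" unfolding lists_image[symmetric] using ys by (auto simp: tuples_def)
    then obtain xs where "set xs \<subseteq> univ A" and map: "ys = map h xs" by (auto simp: lists_eq_set)
    then have xs: "xs \<in> tuples (univ A) (farity L f)" using ys by (simp add: tuples_def)
    then have "fint B f ys = h (fint A f xs)" using h f map by (simp add: embedding_def)
    then show ?thesis using A(1) f xs by (auto simp: is_structure_def)
  qed
  have C: "is_structure L ?C" using A(1) fint by (simp add: is_structure_def)
  have AC: "elem_embedding L A ?C h"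
    using h by (intro isomorphism_elem_embedding[OF A(1)]) (auto simp: embedding_def)
  have "elem_equiv L ?C X"
    by (rule elem_equiv_trans[OF elem_equiv_sym[OF elem_embedding_imp_elem_equiv[OF A(1) AC]] A(2)])
  moreover have "substructure L ?C B"
    using h by (auto simp: substructure_def embedding_def)
  ultimately have "elem_substructure L ?C B"
    using X C B unfolding model_complete_def model_complete_theory_def
    by (simp only: is_model_complete_theory_iff[OF X(1)])
  then have "elem_embedding L ?C B (\<lambda>x. x)"
    by (auto simp: elem_substructure_def substructure_def elem_embedding_def comp_def)
  from elem_embedding_comp[OF AC this] show ?thesis by (simp add: comp_def)
qed

text \<open>The hypotheses range over structures in the large type \<open>'u\<close>; the conclusion
  is about models in an arbitrary type \<open>'v\<close>, of whatever size.\<close>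

theorem theorem3p10:
  fixes L :: "('f, 'r) lang"
    and n :: nat
    and M :: "nat \<Rightarrow> ('f, 'r, 'a) struct"
  assumes universe_large: "Pow (formulas L) \<lesssim> (UNIV :: 'u set)"
    and structures: "\<And>i. i \<in> {1..n} \<Longrightarrow> is_structure L (M i)"
    and factors_mc: "\<And>i. i \<in> {1..n} \<Longrightarrow> model_complete TYPE('u) L (M i)"
    and decomposition: "\<And>S :: ('f, 'r, 'u) struct.
      is_structure L S \<Longrightarrow> aleph0_saturated L S \<Longrightarrow> elem_equiv L S (product {1..n} M) \<Longrightarrow>
      \<exists>M' :: nat \<Rightarrow> ('f, 'r, 'u) struct.
        (\<forall>i\<in>{1..n}. is_structure L (M' i) \<and> elem_equiv L (M' i) (M i)) \<and>
        isomorphic L S (product {1..n} M')"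
    and embeddings: "\<And>(M' :: nat \<Rightarrow> ('f, 'r, 'u) struct) (M'' :: nat \<Rightarrow> ('f, 'r, 'u) struct) \<Psi>.
      (\<And>i. i \<in> {1..n} \<Longrightarrow> is_structure L (M' i) \<and> is_structure L (M'' i) \<and>
         elem_equiv L (M' i) (M i) \<and> elem_equiv L (M i) (M'' i)) \<Longrightarrow>
      embedding L (product {1..n} M') (product {1..n} M'') \<Psi> \<Longrightarrow>
      \<exists>\<sigma> \<Psi>s. \<sigma> permutes {1..n} \<and>
        (\<forall>i\<in>{1..n}. embedding L (M' i) (M'' (\<sigma> i)) (\<Psi>s i)) \<and>
        (\<forall>x\<in>univ (product {1..n} M').
           \<Psi> x = coord_perm {1..n} (inv \<sigma>) (product_map {1..n} \<Psi>s x)) \<and>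
        (\<forall>i\<in>{1..n}. elem_equiv L (M' i) (M'' (\<sigma> i)))"
  shows "model_complete TYPE('v) L (product {1..n} M)"
proof -
  let ?I = "{1..n}"
  let ?P = "product ?I M"
  have P: "is_structure L ?P" using structures by (rule is_structure_product)
  have "elem_substructure L A B"
    if A: "is_structure L A" "elem_equiv L A ?P" and B: "is_structure L B" "elem_equiv L B ?P"
      and AB: "substructure L A B" for A B :: "('f, 'r, 'v) struct"
    unfolding elem_substructure_def
  proof (intro conjI ballI allI impI AB)
    \<comment> \<open>With one assignment fixed, only its countably many values must survive the
      shrinking. \<open>A\<close> is cut down around them, and then \<open>B\<close> around the
      result, which preserves the inclusion.\<close>
    fix \<phi> and e :: "nat \<Rightarrow> 'v" assume \<phi>: "\<phi> \<in> formulas L" and e: "range e \<subseteq> univ A"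
    have "range e \<lesssim> formulas L"
      using image_lepoll lepoll_trans infinite_formulas infinite_le_lepoll by blast
    then obtain X where X: "range e \<subseteq> X" "X \<subseteq> univ A" "X \<lesssim> formulas L"
      "is_structure L (A\<lparr>univ := X\<rparr>)" "elem_embedding L (A\<lparr>univ := X\<rparr>) A (\<lambda>x. x)"
      using downward_Loewenheim_Skolem[OF A(1) e] by blast
    have "X \<subseteq> univ B" using X(2) AB by (auto simp: substructure_def)
    then obtain Y where Y: "X \<subseteq> Y" "Y \<subseteq> univ B" "Y \<lesssim> formulas L"
      "is_structure L (B\<lparr>univ := Y\<rparr>)" "elem_embedding L (B\<lparr>univ := Y\<rparr>) B (\<lambda>x. x)"
      using downward_Loewenheim_Skolem[OF B(1) _ X(3)] by blast
    let ?A = "A\<lparr>univ := X\<rparr>" and ?B = "B\<lparr>univ := Y\<rparr>"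
    have "xs \<in> tuples (univ A) k" if "xs \<in> tuples X k" for xs k
      using that X(2) by (auto simp: tuples_def)
    then have sub: "substructure L ?A ?B"
      using AB X(2) Y(1) by (auto simp: substructure_def embedding_def)
    have card: "univ ?A \<lesssim> formulas L" "univ ?B \<lesssim> formulas L" using X(3) Y(3) by auto
    obtain S T :: "('f, 'r, 'u) struct" and i j h where
      S: "is_structure L S" "aleph0_saturated L S" "elem_embedding L ?A S i" and
      T: "is_structure L T" "aleph0_saturated L T" "elem_embedding L ?B T j" and
      h: "embedding L S T h" "\<forall>a\<in>univ ?A. h (i a) = j a"
      using ex_saturated_extension_pair[OF universe_large X(4) card(1) Y(4) card(2) sub] by blast
    have "elem_equiv L S ?P"
      by (rule elem_equiv_trans[OF elem_equiv_sym[OF elem_embedding_imp_elem_equiv[OF X(4) S(3)]]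
            elem_equiv_trans[OF elem_embedding_imp_elem_equiv[OF X(4,5)] A(2)]])
    from decomposition[OF S(1,2) this] obtain M' :: "nat \<Rightarrow> ('f, 'r, 'u) struct" where
      M': "\<And>k. k \<in> ?I \<Longrightarrow> is_structure L (M' k) \<and> elem_equiv L (M' k) (M k)"
      and "isomorphic L S (product ?I M')" by blast
    then obtain a where a: "embedding L S (product ?I M') a" "a ` univ S = univ (product ?I M')"
      by (auto simp: isomorphic_def)
    have "elem_equiv L T ?P"
      by (rule elem_equiv_trans[OF elem_equiv_sym[OF elem_embedding_imp_elem_equiv[OF Y(4) T(3)]]
            elem_equiv_trans[OF elem_embedding_imp_elem_equiv[OF Y(4,5)] B(2)]])
    from decomposition[OF T(1,2) this] obtain M'' :: "nat \<Rightarrow> ('f, 'r, 'u) struct" where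
      M'': "\<And>k. k \<in> ?I \<Longrightarrow> is_structure L (M'' k) \<and> elem_equiv L (M'' k) (M k)"
      and "isomorphic L T (product ?I M'')" by blast
    then obtain b where b: "embedding L T (product ?I M'') b" "b ` univ T = univ (product ?I M'')"
      by (auto simp: isomorphic_def)
    \<comment> \<open>The embedding of the saturated structures, transported to their
      decompositions.\<close>
    define \<Psi> where "\<Psi> = (b \<circ> h) \<circ> inv_into (univ S) a"
    have \<Psi>: "embedding L (product ?I M') (product ?I M'') \<Psi>"
      unfolding \<Psi>_def
      by (rule embedding_comp[OF embedding_inv_into[OF S(1) a] embedding_comp[OF h(1) b(1)]])
    have "is_structure L (M' k) \<and> is_structure L (M'' k) \<and> elem_equiv L (M' k) (M k) \<and>
        elem_equiv L (M k) (M'' k)" if "k \<in> ?I" for k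
      using M'[OF that] M''[OF that] elem_equiv_sym by blast
    from embeddings[OF this \<Psi>] obtain \<sigma> \<Psi>s where \<sigma>: "\<sigma> permutes ?I"
      and \<Psi>s: "\<And>k. k \<in> ?I \<Longrightarrow> embedding L (M' k) (M'' (\<sigma> k)) (\<Psi>s k)"
      and \<Psi>_eq: "\<And>x. x \<in> univ (product ?I M') \<Longrightarrow>
        \<Psi> x = coord_perm ?I (inv \<sigma>) (product_map ?I \<Psi>s x)"
      and equiv: "\<And>k. k \<in> ?I \<Longrightarrow> elem_equiv L (M' k) (M'' (\<sigma> k))"
      by blast
    have \<tau>: "inv \<sigma> permutes ?I" using \<sigma> by (rule permutes_inv)
    have \<tau>_in: "inv \<sigma> k \<in> ?I" if "k \<in> ?I" for k using permutes_in_image[OF \<tau>] that by blast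
    \<comment> \<open>The factor of the source that lands in factor \<open>k\<close> has index
      \<open>inv \<sigma> k\<close>. By the last clause of the splitting hypothesis both are models
      of the theory of \<open>M (inv \<sigma> k)\<close>, so the model completeness of that
      structure applies.\<close>
    have factor: "elem_embedding L ((M' \<circ> inv \<sigma>) k) (M'' k) (\<Psi>s (inv \<sigma> k))" if k: "k \<in> ?I" for k
    proof -
      have "\<sigma> (inv \<sigma> k) = k" using \<sigma> by (simp add: permutes_inverses)
      then have "embedding L (M' (inv \<sigma> k)) (M'' k) (\<Psi>s (inv \<sigma> k))"
        and "elem_equiv L (M' (inv \<sigma> k)) (M'' k)"
        using \<Psi>s[OF \<tau>_in[OF k]] equiv[OF \<tau>_in[OF k]] by simp_all
      moreover from this(2) have "elem_equiv L (M'' k) (M (inv \<sigma> k))"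
        using M'[OF \<tau>_in[OF k]] by (auto simp: elem_equiv_def)
      ultimately show ?thesis
        using model_complete_embedding_elementary[OF structures[OF \<tau>_in[OF k]] factors_mc[OF \<tau>_in[OF k]]]
          M'[OF \<tau>_in[OF k]] M''[OF k] by simp
    qed
    \<comment> \<open>The hypothesis maps the factors and then permutes. Permuting first gives the
      same map on the product, now composed of an isomorphism and a coordinatewise map that
      preserves indices.\<close>
    define \<psi> where "\<psi> = product_map ?I (\<lambda>k. \<Psi>s (inv \<sigma> k)) \<circ> coord_perm ?I (inv \<sigma>)"
    have \<psi>: "elem_embedding L (product ?I M') (product ?I M'') \<psi>"
      unfolding \<psi>_def
    proof (rule elem_embedding_comp)
      have "is_structure L (product ?I M')" using M' by (intro is_structure_product) blast
      then show "elem_embedding L (product ?I M') (product ?I (M' \<circ> inv \<sigma>)) (coord_perm ?I (inv \<sigma>))"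
        by (rule isomorphism_elem_embedding) (rule coord_perm_isomorphism[OF \<tau>])+
      show "elem_embedding L (product ?I (M' \<circ> inv \<sigma>)) (product ?I M'')
          (product_map ?I (\<lambda>k. \<Psi>s (inv \<sigma> k)))"
        using factor by (intro elem_embedding_product_map) auto
    qed
    have \<psi>_eq: "\<psi> x = \<Psi> x" if "x \<in> univ (product ?I M')" for x
      unfolding \<Psi>_eq[OF that] using \<tau>_in by (auto simp: \<psi>_def coord_perm_def product_map_def)
    have a_elem: "elem_embedding L S (product ?I M') a"
      by (rule isomorphism_elem_embedding[OF S(1) a])
    have b_elem: "elem_embedding L T (product ?I M'') b"
      by (rule isomorphism_elem_embedding[OF T(1) b])
    have via_S: "elem_embedding L ?A (product ?I M'') (\<psi> \<circ> (a \<circ> i))"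
      by (rule elem_embedding_comp[OF elem_embedding_comp[OF S(3) a_elem] \<psi>])
    have via_T: "elem_embedding L ?B (product ?I M'') (b \<circ> j)"
      by (rule elem_embedding_comp[OF T(3) b_elem])
    have "\<psi> (a (i x)) = b (j x)" if x: "x \<in> X" for x
    proof -
      have iS: "i x \<in> univ S" using S(3) x by (auto simp: elem_embedding_def)
      then have "a (i x) \<in> univ (product ?I M')" using a(2) by blast
      moreover have "inv_into (univ S) a (a (i x)) = i x"
        using a(1) iS by (simp add: embedding_def inv_into_f_f)
      ultimately show ?thesis using \<psi>_eq h(2) x by (simp add: \<Psi>_def)
    qed
    \<comment> \<open>The two routes into the product of the \<open>M''\<close>, through
      \<open>S\<close> and through \<open>T\<close>, agree on the values of \<open>e\<close>. Both
      are elementary, so the truth of \<phi> can be carried from \<open>A\<close> to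
      \<open>B\<close>.\<close>
    then have same: "\<psi> \<circ> (a \<circ> i) \<circ> e = b \<circ> j \<circ> e"
      using X(1) by (auto simp: fun_eq_iff image_subset_iff)
    have eA: "range e \<subseteq> univ ?A" and eB: "range e \<subseteq> univ ?B" using X(1) Y(1) by auto
    have "sat A e \<phi> \<longleftrightarrow> sat ?A e \<phi>"
      using X(5) \<phi> eA unfolding elem_embedding_def comp_def by blast
    also have "\<dots> \<longleftrightarrow> sat (product ?I M'') (b \<circ> j \<circ> e) \<phi>"
      using via_S \<phi> eA unfolding elem_embedding_def same[symmetric] by blast
    also have "\<dots> \<longleftrightarrow> sat ?B e \<phi>"
      using via_T \<phi> eB unfolding elem_embedding_def by blast
    also have "\<dots> \<longleftrightarrow> sat B e \<phi>"
      using Y(5) \<phi> eB unfolding elem_embedding_def comp_def by blast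
    finally show "sat A e \<phi> \<longleftrightarrow> sat B e \<phi>" .
  qed
  then show ?thesis
    unfolding model_complete_def model_complete_theory_def is_model_complete_theory_iff[OF P] by blast
qed

end
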